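(* Let $\mathcal{H}_A^{\otimes n}=\mathcal{H}_B^{\otimes n}=(\mathbb{C}^d)^{\otimes n}$ and $\mathcal{H}_{AB}^{\otimes n}=(\mathcal{H}_A\otimes\mathcal{H}_B)^{\otimes n}=\mathcal{H}_A^{\otimes n}\otimes\mathcal{H}_B^{\otimes n}$. The antisymmetric projector $$P_{as}=\frac{1}{n!}\sum_{\sigma\in S(n)}\operatorname{sgn}(\sigma)\,V^A_\sigma\otimes V^B_\sigma$$ acting on $\mathcal{H}_{AB}^{\otimes n}$ can be written in the form $$P_{as}=\bigoplus_{\lambda\vdash n}\mathbf{1}^A_\lambda\otimes\mathbf{1}^B_{\lambda^t}\otimes W^{AB}_{\lambda\lambda^t},$$ where the identities act on the unitary parts and the operator $W^{AB}_{\lambda\lambda^t}$ acts on the symmetric part (the tensor product of the symmetric-group representation spaces for $\lambda$ on $A$ and $\lambda^t$ on $B$) of the Schur-Weyl decomposition. Here $\lambda^t$ denotes the conjugate Young diagram of $\lambda$, and $W^{AB}_{\lambda\lambda^t}=|\psi\rangle\langle\psi|^{\lambda,\lambda^t}_{AB}$, where $$|\psi\rangle^{\lambda,\lambda^t}_{AB}=\sum_{T_\lambda}\operatorname{sgn}(T_\lambda)\,|T_\lambda\rangle_A|T_{\lambda^t}\rangle_B ,$$ the sum running over all standard Young tableaux $T_\lambda$ of shape $\lambda$, with $T_{\lambda^t}$ the conjugate (transposed) tableau of $T_\lambda$.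
   Context: Permutation operators: for $\sigma\in S(n)$ (the symmetric group), $V_\sigma$ acts on $(\mathbb{C}^d)^{\otimes n}$ by $V_\sigma(e_{i_1}\otimes\cdots\otimes e_{i_n})=e_{i_{\sigma^{-1}(1)}}\otimes\cdots\otimes e_{i_{\sigma^{-1}(n)}}$, where $\{e_i\}_{i=1}^d$ is an orthonormal basis of $\mathbb{C}^d$; $V^A_\sigma,V^B_\sigma$ denote these operators on $\mathcal{H}_A^{\otimes n},\mathcal{H}_B^{\otimes n}$. Schur-Weyl duality: $(\mathbb{C}^d)^{\otimes n}\cong\bigoplus_{\lambda\vdash n}\mathcal{U}_\lambda\otimes\mathcal{S}_\lambda$, where $\mathcal{U}_\lambda$ (the unitary part) is the corresponding representation space of the unitary group and $\mathcal{S}_\lambda$ (the symmetric part) is the space of the irreducible Young-Yamanouchi representation $D^\lambda$ of $S(n)$, so that $V_\sigma=\bigoplus_\lambda \mathbf{1}_\lambda\otimes D^\lambda(\sigma)$. Tensor factors are reordered so that the two unitary-group factors come first. Standard Young tableaux of shape $\lambda$ are bijective fillings of the Young diagram of $\lambda$ by $1,\ldots,n$ increasing to the right along rows and downwards along columns; conjugation (of diagrams and tableaux) interchanges rows and columns. A permutation acts on a tableau by acting on each entry. Fix an arbitrarily chosen standard Young tableau $T^\times_\lambda$ of shape $\lambda$; then $\operatorname{sgn}(T_\lambda)=\operatorname{sgn}(\sigma)$, where $\sigma\in S(n)$ is the permutation with $\sigma(T^\times_\lambda)=T_\lambda$. Axial distance: $\rho(T;i,j)$ is the signed number of horizontal or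 vertical steps from the box containing $i$ to the box containing $j$ in $T$, each step down or left counting $+1$, each step up or right counting $-1$. Young-Yamanouchi representation: $\mathcal{S}_\lambda$ has orthonormal basis $\{|T\rangle\}$ indexed by the standard Young tableaux $T$ of shape $\lambda$, and $$D^{\lambda}(k\ k+1)|T\rangle=\frac{1}{\rho(T;k+1,k)}|T\rangle+\sqrt{1-\frac{1}{\rho(T;k+1,k)^2}}\;|(k\ k+1)T\rangle,\quad k=1,\ldots,n-1,$$ the second term appearing only if $(k\ k+1)T$ is standard.
   Formalization: The vector |ψ⟩ is normalised by 1/√f, with f the number of standard Young tableaux of shape λ; without this factor the printed formula fails (n=3, d≥2, λ=(2,1): W²=2W, so the right-hand side is not a projector). *)

theory Defs
  imports Complex_Main "HOL-Library.FuncSet" "HOL-Combinatorics.Permutations"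
begin

section \<open>Linear maps as matrices over explicit finite index sets\<close>

text \<open>
  A linear map from \<open>\<complex>\<^sup>J\<close> to \<open>\<complex>\<^sup>I\<close> is given by its entries \<open>A i j\<close> in the standard bases
  (row first); only the entries with \<open>i \<in> I\<close>, \<open>j \<in> J\<close> matter.
\<close>

type_synonym ('i, 'j) cmat = "'i \<Rightarrow> 'j \<Rightarrow> complex"

definition ket :: "'i \<Rightarrow> 'i \<Rightarrow> complex" where
  "ket a i = (if i = a then 1 else 0)"

definition ketbra :: "('i \<Rightarrow> complex) \<Rightarrow> ('i, 'i) cmat" where
  "ketbra v i j = v i * cnj (v j)"

definition one_mat :: "('i, 'i) cmat" where
  "one_mat i j = (if i = j then 1 else 0)"

definition mat_prod :: "'k set \<Rightarrow> ('i, 'k) cmat \<Rightarrow> ('k, 'j) cmat \<Rightarrow> ('i, 'j) cmat" where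
  "mat_prod K A B i j = (\<Sum>k\<in>K. A i k * B k j)"

definition adj :: "('i, 'j) cmat \<Rightarrow> ('j, 'i) cmat" where
  "adj A j i = cnj (A i j)"

definition mat_eq :: "'i set \<Rightarrow> 'j set \<Rightarrow> ('i, 'j) cmat \<Rightarrow> ('i, 'j) cmat \<Rightarrow> bool" where
  "mat_eq I J A B \<longleftrightarrow> (\<forall>i\<in>I. \<forall>j\<in>J. A i j = B i j)"

definition unitary_mat :: "'i set \<Rightarrow> 'j set \<Rightarrow> ('i, 'j) cmat \<Rightarrow> bool" where
  "unitary_mat I J A \<longleftrightarrow>
     mat_eq J J (mat_prod I (adj A) A) one_mat \<and> mat_eq I I (mat_prod J A (adj A)) one_mat"

definition tensor :: "('i, 'j) cmat \<Rightarrow> ('k, 'l) cmat \<Rightarrow> ('i \<times> 'k, 'j \<times> 'l) cmat"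
    (infixr "\<otimes>\<^sub>M" 75) where
  "(A \<otimes>\<^sub>M B) x y = A (fst x) (fst y) * B (snd x) (snd y)"

text \<open>The block-diagonal operator \<open>\<Oplus>\<^sub>l F l\<close>; block labels come first in the index.\<close>

definition dsum :: "('l \<Rightarrow> ('i, 'i) cmat) \<Rightarrow> ('l \<times> 'i, 'l \<times> 'i) cmat" where
  "dsum F x y = (if fst x = fst y then F (fst x) (snd x) (snd y) else 0)"

text \<open>\<open>transport K \<Phi> R\<close> is \<open>\<Phi> R \<Phi>\<^sup>*\<close>: the operator \<open>R\<close> on \<open>\<complex>\<^sup>K\<close> carried over along \<open>\<Phi>\<close>.\<close>

definition transport :: "'k set \<Rightarrow> ('i, 'k) cmat \<Rightarrow> ('k, 'k) cmat \<Rightarrow> ('i, 'i) cmat" where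
  "transport K \<Phi> R = mat_prod K (mat_prod K \<Phi> R) (adj \<Phi>)"


section \<open>The tensor power and its permutation operators\<close>

text \<open>
  The index \<open>x\<close> labels the basis vector \<open>e\<^bsub>x 1\<^esub> \<otimes> \<dots> \<otimes> e\<^bsub>x n\<^esub>\<close> of the n-fold tensor power of \<open>\<complex>\<^sup>d\<close>.
\<close>

definition tidx :: "nat \<Rightarrow> nat \<Rightarrow> (nat \<Rightarrow> nat) set" where
  "tidx d n = {1..n} \<rightarrow>\<^sub>E {1..d}"

definition Sym :: "nat \<Rightarrow> (nat \<Rightarrow> nat) set" where
  "Sym n = {\<sigma>. \<sigma> permutes {1..n}}"

definition perm_op :: "(nat \<Rightarrow> nat) \<Rightarrow> (nat \<Rightarrow> nat, nat \<Rightarrow> nat) cmat" where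
  "perm_op \<sigma> x y = ket (y \<circ> inv \<sigma>) x"

definition tensor_power :: "nat \<Rightarrow> (nat, nat) cmat \<Rightarrow> (nat \<Rightarrow> nat, nat \<Rightarrow> nat) cmat" where
  "tensor_power n U x y = (\<Prod>k\<in>{1..n}. U (x k) (y k))"

definition P_as ::
    "nat \<Rightarrow> ((nat \<Rightarrow> nat) \<times> (nat \<Rightarrow> nat), (nat \<Rightarrow> nat) \<times> (nat \<Rightarrow> nat)) cmat" where
  "P_as n x y = 1 / fact n * (\<Sum>\<sigma>\<in>Sym n. of_int (sign \<sigma>) * (perm_op \<sigma> \<otimes>\<^sub>M perm_op \<sigma>) x y)"


section \<open>Young diagrams and standard tableaux\<close>

text \<open>
  A partition is identified with its Young diagram, the set of boxes \<open>(row, column)\<close>, numbered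
  from 0; row numbers grow downwards.
\<close>

type_synonym diagram = "(nat \<times> nat) set"
type_synonym tableau = "nat \<times> nat \<Rightarrow> nat"

definition diagrams :: "nat \<Rightarrow> diagram set" where
  "diagrams n = {L. finite L \<and> card L = n \<and>
     (\<forall>i j i' j'. (i, j) \<in> L \<and> i' \<le> i \<and> j' \<le> j \<longrightarrow> (i', j') \<in> L)}"

definition conj_diagram :: "diagram \<Rightarrow> diagram" where
  "conj_diagram L = prod.swap ` L"

text \<open>
  A tableau has the value 0 off its diagram. This makes equality of tableaux extensional on the
  diagram, and since permutations of \<open>{1..n}\<close> fix 0, such a \<open>\<sigma>\<close> acts on a tableau \<open>T\<close> by \<open>\<sigma> \<circ> T\<close>.
\<close>

definition SYT :: "diagram \<Rightarrow> tableau set" where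
  "SYT L = {T. bij_betw T L {1..card L} \<and> (\<forall>b. b \<notin> L \<longrightarrow> T b = 0) \<and>
     (\<forall>i j j'. (i, j) \<in> L \<and> (i, j') \<in> L \<and> j < j' \<longrightarrow> T (i, j) < T (i, j')) \<and>
     (\<forall>i i' j. (i, j) \<in> L \<and> (i', j) \<in> L \<and> i < i' \<longrightarrow> T (i, j) < T (i', j))}"

definition conj_tableau :: "tableau \<Rightarrow> tableau" where
  "conj_tableau T = T \<circ> prod.swap"

definition tableau_sign :: "nat \<Rightarrow> tableau \<Rightarrow> tableau \<Rightarrow> int" where
  "tableau_sign n T0 T = sign (THE \<sigma>. \<sigma> permutes {1..n} \<and> \<sigma> \<circ> T0 = T)"

definition box_of :: "tableau \<Rightarrow> nat \<Rightarrow> nat \<times> nat" where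
  "box_of T k = (THE b. T b = k)"

definition axial_distance :: "tableau \<Rightarrow> nat \<Rightarrow> nat \<Rightarrow> int" where
  "axial_distance T i j =
     (int (fst (box_of T j)) - int (fst (box_of T i))) +
     (int (snd (box_of T i)) - int (snd (box_of T j)))"


section \<open>The Young-Yamanouchi representation\<close>

text \<open>
  \<open>D\<close> is the representation of \<open>S(n)\<close> on \<open>\<complex>\<^bsup>SYT L\<^esup>\<close> with the prescribed values on the adjacent
  transpositions; as these generate \<open>S(n)\<close>, \<open>D\<close> is determined by \<open>L\<close>. In the last clause the ket of
  \<open>(k k+1)T\<close> is evaluated at standard tableaux only, so it drops out if \<open>(k k+1)T\<close> is not standard.
\<close>

definition young_yamanouchi ::
    "nat \<Rightarrow> diagram \<Rightarrow> ((nat \<Rightarrow> nat) \<Rightarrow> (tableau, tableau) cmat) \<Rightarrow> bool" where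
  "young_yamanouchi n L D \<longleftrightarrow>
     mat_eq (SYT L) (SYT L) (D id) one_mat \<and>
     (\<forall>\<sigma>\<in>Sym n. \<forall>\<tau>\<in>Sym n.
        mat_eq (SYT L) (SYT L) (D (\<sigma> \<circ> \<tau>)) (mat_prod (SYT L) (D \<sigma>) (D \<tau>))) \<and>
     (\<forall>k\<in>{1..<n}. \<forall>T\<in>SYT L. \<forall>S\<in>SYT L.
        (let r = complex_of_real (1 / real_of_int (axial_distance T (k + 1) k));
             q = complex_of_real (sqrt (1 - 1 / (real_of_int (axial_distance T (k + 1) k))\<^sup>2))
         in D (transpose k (k + 1)) S T = r * ket T S + q * ket (transpose k (k + 1) \<circ> T) S))"


section \<open>Schur-Weyl decompositions\<close>

text \<open>
  Index set of \<open>\<Oplus>\<^bsub>\<lambda>\<^esub> \<U>\<^bsub>\<lambda>\<^esub> \<otimes> \<S>\<^bsub>\<lambda>\<^esub>\<close>, where \<open>m \<lambda>\<close> is the dimension of \<open>\<U>\<^bsub>\<lambda>\<^esub>\<close> (possibly 0, as for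
  diagrams with more than \<open>d\<close> rows).
\<close>

definition sw_idx :: "nat \<Rightarrow> (diagram \<Rightarrow> nat) \<Rightarrow> (diagram \<times> nat \<times> tableau) set" where
  "sw_idx n m = (SIGMA L : diagrams n. {..<m L} \<times> SYT L)"

definition unitary_group_rep :: "nat \<Rightarrow> nat \<Rightarrow> ((nat, nat) cmat \<Rightarrow> (nat, nat) cmat) \<Rightarrow> bool" where
  "unitary_group_rep d m \<pi> \<longleftrightarrow>
     mat_eq {..<m} {..<m} (\<pi> one_mat) one_mat \<and>
     (\<forall>U V. unitary_mat {1..d} {1..d} U \<and> unitary_mat {1..d} {1..d} V \<longrightarrow>
        mat_eq {..<m} {..<m} (\<pi> (mat_prod {1..d} U V)) (mat_prod {..<m} (\<pi> U) (\<pi> V)))"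

text \<open>
  \<open>\<Phi>\<close> is a unitary from \<open>\<Oplus>\<^bsub>\<lambda>\<^esub> \<U>\<^bsub>\<lambda>\<^esub> \<otimes> \<S>\<^bsub>\<lambda>\<^esub>\<close> onto the tensor power under which permutations act as
  \<open>\<Oplus>\<^bsub>\<lambda>\<^esub> 1 \<otimes> D\<^bsub>\<lambda>\<^esub>(\<sigma>)\<close> and the n-fold tensor power of a unitary as \<open>\<Oplus>\<^bsub>\<lambda>\<^esub> \<pi>\<^bsub>\<lambda>\<^esub>(U) \<otimes> 1\<close>. Irreducibility of
  the nonzero \<open>\<pi>\<^bsub>\<lambda>\<^esub>\<close> need not be demanded; it follows from double commutation.
\<close>

definition schur_weyl ::
    "nat \<Rightarrow> nat \<Rightarrow> (diagram \<Rightarrow> (nat \<Rightarrow> nat) \<Rightarrow> (tableau, tableau) cmat) \<Rightarrow> (diagram \<Rightarrow> nat) \<Rightarrow>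
     (nat \<Rightarrow> nat, diagram \<times> nat \<times> tableau) cmat \<Rightarrow> bool" where
  "schur_weyl d n D m \<Phi> \<longleftrightarrow>
     unitary_mat (tidx d n) (sw_idx n m) \<Phi> \<and>
     (\<forall>\<sigma>\<in>Sym n. mat_eq (tidx d n) (tidx d n) (perm_op \<sigma>)
        (transport (sw_idx n m) \<Phi> (dsum (\<lambda>L. one_mat \<otimes>\<^sub>M D L \<sigma>)))) \<and>
     (\<exists>\<pi>. (\<forall>L\<in>diagrams n. unitary_group_rep d (m L) (\<pi> L)) \<and>
        (\<forall>U. unitary_mat {1..d} {1..d} U \<longrightarrow>
           mat_eq (tidx d n) (tidx d n) (tensor_power n U)
             (transport (sw_idx n m) \<Phi> (dsum (\<lambda>L. \<pi> L U \<otimes>\<^sub>M one_mat)))))"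


section \<open>The operator on the symmetric part\<close>

text \<open>
  The factor \<open>1 / sqrt (card (SYT L))\<close> normalises the vector, whose terms are orthonormal. It is
  needed for the operator built from \<open>ketbra (psi \<dots>)\<close> to be idempotent.
\<close>

definition psi :: "nat \<Rightarrow> tableau \<Rightarrow> diagram \<Rightarrow> tableau \<times> tableau \<Rightarrow> complex" where
  "psi n T0 L x = complex_of_real (1 / sqrt (real (card (SYT L)))) *
     (\<Sum>T\<in>SYT L. of_int (tableau_sign n T0 T) * (ket T (fst x) * ket (conj_tableau T) (snd x)))"

text \<open>
  Moves both block labels to the front, then the two unitary factors, then the two symmetric ones.
\<close>

definition reorder ::
    "('l \<times> 'u \<times> 's) \<times> ('l \<times> 'u \<times> 's) \<Rightarrow> ('l \<times> 'l) \<times> ('u \<times> 'u) \<times> ('s \<times> 's)" where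
  "reorder = (\<lambda>((l, u, s), (l', u', s')). ((l, l'), (u, u'), (s, s')))"

text \<open>
  On the product of two Schur-Weyl decompositions the blocks are labelled by pairs \<open>(\<lambda>, \<mu>)\<close>; the
  operator \<open>\<Oplus>\<^bsub>\<lambda>\<^esub> 1 \<otimes> 1 \<otimes> W\<^bsub>\<lambda>\<^esub>\<close> vanishes on those with \<open>\<mu>\<close> different from the conjugate of \<open>\<lambda>\<close>.
\<close>

definition conj_pair_dsum ::
    "(diagram \<Rightarrow> (tableau \<times> tableau, tableau \<times> tableau) cmat) \<Rightarrow>
     ((diagram \<times> nat \<times> tableau) \<times> (diagram \<times> nat \<times> tableau),
      (diagram \<times> nat \<times> tableau) \<times> (diagram \<times> nat \<times> tableau)) cmat" where
  "conj_pair_dsum W x y =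
     dsum (\<lambda>(L, M). if M = conj_diagram L then (one_mat \<otimes>\<^sub>M one_mat) \<otimes>\<^sub>M W L else (\<lambda>_ _. 0))
       (reorder x) (reorder y)"

end

theory Submission
  imports Defs
begin

text \<open>
  On the block \<open>(\<lambda>, \<mu>)\<close> the operator \<open>P\<^sub>a\<^sub>s\<close> acts as the average of \<open>sgn \<sigma> D\<^sup>\<lambda>(\<sigma>) \<otimes> D\<^sup>\<mu>(\<sigma>)\<close>, whose
  rows and columns are vectors \<open>v\<close> with \<open>(D\<^sup>\<lambda>(s) \<otimes> D\<^sup>\<mu>(s)) v = -v\<close> for every adjacent transposition
  \<open>s\<close>. On such a \<open>v\<close> the Jucys-Murphy elements of the two factors act with opposite signs. Their
  eigenvalues on \<open>|S\<rangle>\<close> are the contents of the boxes of \<open>S\<close>, and these determine \<open>S\<close>; transposing a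
  tableau negates them. Hence \<open>v\<close> is a combination of the vectors \<open>|S\<rangle>|S\<^sup>t\<rangle>\<close>, and the relations for
  adjacent transpositions, which connect all standard tableaux of a given shape, force its
  coefficients to be proportional to the signs. The constant is found from the orthogonality of
  \<open>D\<^sup>\<lambda>\<close>.
\<close>

section \<open>Contents of standard tableaux\<close>

text \<open>Axial distances become differences of contents, so that each single entry carries an
  eigenvalue.\<close>

definition content :: "tableau \<Rightarrow> nat \<Rightarrow> int" where
  "content T k = int (snd (box_of T k)) - int (fst (box_of T k))"

lemma axial_distance_content: "axial_distance T i j = content T i - content T j"
  by (simp add: axial_distance_def content_def)

lemma diagramsD:
  assumes "L \<in> diagrams n"
  shows "finite L" "card L = n"
    and "\<And>i j i' j'. (i, j) \<in> L \<Longrightarrow> i' \<le> i \<Longrightarrow> j' \<le> j \<Longrightarrow> (i', j') \<in> L"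
  using assms unfolding diagrams_def by blast+

lemma SYT_D:
  assumes "T \<in> SYT L"
  shows SYT_bij: "bij_betw T L {1..card L}"
    and SYT_off: "\<And>b. b \<notin> L \<Longrightarrow> T b = 0"
    and SYT_row: "\<And>i j j'. (i, j) \<in> L \<Longrightarrow> (i, j') \<in> L \<Longrightarrow> j < j' \<Longrightarrow> T (i, j) < T (i, j')"
    and SYT_col: "\<And>i i' j. (i, j) \<in> L \<Longrightarrow> (i', j) \<in> L \<Longrightarrow> i < i' \<Longrightarrow> T (i, j) < T (i', j)"
  using assms unfolding SYT_def by blast+

lemma finite_SYT:
  assumes "L \<in> diagrams n"
  shows "finite (SYT L)"
proof (rule finite_subset)
  show "SYT L \<subseteq> {f. \<forall>b. (b \<in> L \<longrightarrow> f b \<in> {1..card L}) \<and> (b \<notin> L \<longrightarrow> f b = 0)}"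
    by (auto simp: SYT_def bij_betw_def)
  show "finite {f. \<forall>b. (b \<in> L \<longrightarrow> f b \<in> {1..card L}) \<and> (b \<notin> L \<longrightarrow> f b = (0::nat))}"
    using diagramsD(1)[OF assms] by (intro finite_set_of_finite_funs) auto
qed

lemma box_of_entry:
  assumes T: "T \<in> SYT L" and b: "b \<in> L"
  shows "box_of T (T b) = b"
proof -
  \<comment> \<open>The value 0 off \<open>L\<close> is never an entry, so a box with the value
    \<open>T b\<close> lies in \<open>L\<close> and injectivity applies.\<close>
  have "T b \<ge> 1"
    using bij_betwE[OF SYT_bij[OF T]] b by auto
  then have "b' \<in> L" if "T b' = T b" for b'
    using SYT_off[OF T, of b'] that by (cases "b' \<in> L") auto
  then have "b' = b" if "T b' = T b" for b'
    using bij_betw_imp_inj_on[OF SYT_bij[OF T]] b that by (metis inj_onD)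
  then show ?thesis
    unfolding box_of_def by (intro the_equality) auto
qed

lemma box_of_props:
  assumes T: "T \<in> SYT L" and k: "k \<in> {1..card L}"
  shows "box_of T k \<in> L" "T (box_of T k) = k"
proof -
  have "k \<in> T ` L"
    using bij_betw_imp_surj_on[OF SYT_bij[OF T]] k by simp
  then obtain b where "b \<in> L" "T b = k"
    by blast
  with box_of_entry[OF T, of b] show "box_of T k \<in> L" "T (box_of T k) = k"
    by simp_all
qed

text \<open>Move along the row and then down the column; the corner \<open>(i, j')\<close> belongs
  to \<open>L\<close> because diagrams are closed to the upper left.\<close>

lemma SYT_mono:
  assumes L: "L \<in> diagrams n" and T: "T \<in> SYT L" and b: "(i', j') \<in> L"
    and le: "i \<le> i'" "j \<le> j'" and ne: "(i, j) \<noteq> (i', j')"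
  shows "T (i, j) < T (i', j')"
proof -
  have in_L: "(i, j) \<in> L" "(i, j') \<in> L"
    using diagramsD(3)[OF L b] le by auto
  have "T (i, j) \<le> T (i, j')"
    using SYT_row[OF T in_L] le by (cases "j = j'") auto
  moreover have "T (i, j') \<le> T (i', j')"
    using SYT_col[OF T in_L(2) b] le by (cases "i = i'") auto
  moreover have "T (i, j) < T (i, j') \<or> T (i, j') < T (i', j')"
    using SYT_row[OF T in_L] SYT_col[OF T in_L(2) b] le ne by (cases "j = j'") auto
  ultimately show ?thesis by linarith
qed

text \<open>The second box cannot lie strictly below and strictly to the right of the first, since
  the corner between them would hold an entry strictly between \<open>k\<close> and
  \<open>k + 1\<close>.\<close>

lemma consecutive_boxes:
  assumes L: "L \<in> diagrams n" and T: "T \<in> SYT L" and k: "k \<in> {1..<n}"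
    and b: "box_of T k = (i, j)" and b': "box_of T (k + 1) = (i', j')"
  shows "i = i' \<and> j < j' \<or> i < i' \<and> j = j' \<or> i < i' \<and> j' < j \<or> i' < i \<and> j < j'"
proof -
  have k_in: "k \<in> {1..card L}" "k + 1 \<in> {1..card L}"
    using k diagramsD(2)[OF L] by auto
  have in_L: "(i, j) \<in> L" "(i', j') \<in> L" and v: "T (i, j) = k" "T (i', j') = k + 1"
    using box_of_props[OF T k_in(1)] box_of_props[OF T k_in(2)] b b' by auto
  have "\<not> (i' \<le> i \<and> j' \<le> j)"
    using SYT_mono[OF L T in_L(1), of i' j'] v by fastforce
  moreover have "\<not> (i < i' \<and> j < j')"
  proof
    assume *: "i < i' \<and> j < j'"
    then have "(i, j') \<in> L"
      using diagramsD(3)[OF L in_L(2)] by auto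
    then have "T (i, j) < T (i, j')" "T (i, j') < T (i', j')"
      using SYT_mono[OF L T] in_L * by auto
    with v show False by simp
  qed
  ultimately show ?thesis by linarith
qed

text \<open>Rules out a zero denominator in the diagonal entries of the Young-Yamanouchi
  matrices.\<close>

lemma content_Suc_neq:
  assumes "L \<in> diagrams n" "T \<in> SYT L" "k \<in> {1..<n}"
  shows "content T (k + 1) \<noteq> content T k"
proof -
  obtain i j i' j' where b: "box_of T k = (i, j)" "box_of T (k + 1) = (i', j')"
    by (meson surj_pair)
  show ?thesis
    using consecutive_boxes[OF assms b] by (auto simp: content_def b[simplified])
qed

lemma box_of_transpose:
  assumes T: "T \<in> SYT L" and T': "transpose k l \<circ> T \<in> SYT L" and j: "j \<in> {1..card L}"
    and kl: "k \<in> {1..card L}" "l \<in> {1..card L}"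
  shows "box_of (transpose k l \<circ> T) j = box_of T (transpose k l j)"
proof -
  have "transpose k l j \<in> {1..card L}"
    using j kl by (auto simp: transpose_def)
  note b = box_of_props[OF T this]
  have "(transpose k l \<circ> T) (box_of T (transpose k l j)) = j"
    using b(2) by simp
  then show ?thesis
    using box_of_entry[OF T' b(1)] by simp
qed

lemma content_transpose:
  assumes "L \<in> diagrams n" "T \<in> SYT L" "transpose k (k + 1) \<circ> T \<in> SYT L" "k \<in> {1..<n}"
  shows "content (transpose k (k + 1) \<circ> T) k = content T (k + 1)"
    and "content (transpose k (k + 1) \<circ> T) (k + 1) = content T k"
  unfolding content_def
  using assms diagramsD(2)[OF assms(1)] by (simp_all add: box_of_transpose)

text \<open>\<open>consecutive_boxes\<close> applies to the two boxes in either order. Only the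
  positions below left and above right survive both, and there row and column each contribute at
  least 1.\<close>

lemma abs_content_diff_ge_2:
  assumes L: "L \<in> diagrams n" and T: "T \<in> SYT L" and T': "transpose k (k + 1) \<circ> T \<in> SYT L"
    and k: "k \<in> {1..<n}"
  shows "\<bar>content T (k + 1) - content T k\<bar> \<ge> 2"
proof -
  obtain i j i' j' where b: "box_of T k = (i, j)" "box_of T (k + 1) = (i', j')"
    by (meson surj_pair)
  have "box_of (transpose k (k + 1) \<circ> T) (k + 1) = (i, j)"
       "box_of (transpose k (k + 1) \<circ> T) k = (i', j')"
    using T T' k diagramsD(2)[OF L] b by (simp_all add: box_of_transpose)
  from consecutive_boxes[OF L T k b] consecutive_boxes[OF L T' k this(2,1)]
  show ?thesis
    by (auto simp: content_def b[simplified])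
qed

text \<open>Only boxes on one diagonal compete for the entry \<open>k\<close>, and the upper left one wins.\<close>

lemma content_determines_box_aux:
  assumes L': "L' \<in> diagrams n" and T: "T \<in> SYT L" and T': "T' \<in> SYT L'"
    and k: "k \<in> {1..n}" and cL: "card L = n"
    and IH: "\<And>j. j \<in> {1..n} \<Longrightarrow> j < k \<Longrightarrow> box_of T j = box_of T' j"
    and b: "box_of T k = (i, j)" and b': "box_of T' k = (i + t, j + t)"
  shows "t = 0"
proof (rule ccontr)
  assume "t \<noteq> 0"
  have c: "card L' = n" using diagramsD(2)[OF L'] .
  have in_L': "(i + t, j + t) \<in> L'" and v: "T' (i + t, j + t) = k"
    using box_of_props[OF T', of k] k c b' by simp_all
  then have "(i, j) \<in> L'"
    using diagramsD(3)[OF L'] by auto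
  have lt: "T' (i, j) < k"
    using SYT_mono[OF L' T' in_L', of i j] \<open>t \<noteq> 0\<close> v by auto
  have r: "T' (i, j) \<in> {1..n}"
    using bij_betwE[OF SYT_bij[OF T']] \<open>(i, j) \<in> L'\<close> c by auto
  have "box_of T (T' (i, j)) = (i, j)"
    using IH[OF r lt] box_of_entry[OF T' \<open>(i, j) \<in> L'\<close>] by simp
  then have "T (i, j) = T' (i, j)" "T (i, j) = k"
    using box_of_props(2)[OF T] k b cL r by metis+
  then show False
    using lt by simp
qed

text \<open>Equal contents put both boxes on one diagonal, so they differ by a diagonal shift. The
  preceding lemma, used with either tableau in either role, makes the shift 0.\<close>

lemma content_determines_box:
  assumes L: "L \<in> diagrams n" and L': "L' \<in> diagrams n" and T: "T \<in> SYT L" and T': "T' \<in> SYT L'"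
    and c: "\<And>k. k \<in> {1..n} \<Longrightarrow> content T k = content T' k"
    and "k \<in> {1..n}"
  shows "box_of T k = box_of T' k"
  using \<open>k \<in> {1..n}\<close>
proof (induction k rule: less_induct)
  case (less k)
  obtain i j i' j' where b: "box_of T k = (i, j)" "box_of T' k = (i', j')"
    by (meson surj_pair)
  have eq: "int j - int i = int j' - int i'"
    using c[OF less.prems] by (simp add: content_def b)
  have IH: "\<And>j. j \<in> {1..n} \<Longrightarrow> j < k \<Longrightarrow> box_of T j = box_of T' j"
    using less.IH by blast
  show ?case
  proof (cases "i \<le> i'")
    case True
    define t where "t = i' - i"
    have "i' = i + t" "j' = j + t"
      using True eq unfolding t_def by linarith+
    then show ?thesis
      using content_determines_box_aux[OF L' T T' less.prems diagramsD(2)[OF L] IH, of i j t]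
      unfolding b by simp
  next
    case False
    define t where "t = i - i'"
    have "i = i' + t" "j = j' + t"
      using False eq unfolding t_def by linarith+
    then show ?thesis
      using content_determines_box_aux[OF L T' T less.prems diagramsD(2)[OF L'] IH[symmetric], of i' j' t]
      unfolding b by simp
  qed
qed

text \<open>The shapes are not assumed equal: each box of \<open>L\<close> is found in
  \<open>L'\<close> with the same entry, and equal cardinality then identifies the shapes.\<close>

lemma content_determines_tableau:
  assumes L: "L \<in> diagrams n" and L': "L' \<in> diagrams n" and T: "T \<in> SYT L" and T': "T' \<in> SYT L'"
    and c: "\<And>k. k \<in> {1..n} \<Longrightarrow> content T k = content T' k"
  shows "L = L'" "T = T'"
proof -
  have cards: "card L = n" "card L' = n"
    using diagramsD(2)[OF L] diagramsD(2)[OF L'] by simp_all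
  have eq: "box_of T k = box_of T' k" if "k \<in> {1..n}" for k
    using content_determines_box[OF L L' T T' c that] .
  have sub: "b \<in> L' \<and> T b = T' b" if "b \<in> L" for b
  proof -
    have "T b \<in> {1..n}"
      using bij_betwE[OF SYT_bij[OF T]] that cards by auto
    moreover from this have "box_of T' (T b) = b"
      using eq[of "T b"] box_of_entry[OF T that] by metis
    ultimately show ?thesis
      using box_of_props[OF T', of "T b"] cards by simp
  qed
  then show "L = L'"
    using diagramsD(1)[OF L'] cards by (intro card_subset_eq) auto
  then show "T = T'"
    using sub SYT_off[OF T] SYT_off[OF T'] by (metis ext)
qed

section \<open>Conjugation and its effect on contents\<close>

lemma conj_diagram_in_diagrams: "L \<in> diagrams n \<Longrightarrow> conj_diagram L \<in> diagrams n"
proof -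
  assume L: "L \<in> diagrams n"
  have "(i, j) \<in> conj_diagram L \<longleftrightarrow> (j, i) \<in> L" for i j
    unfolding conj_diagram_def by force
  moreover have "finite (conj_diagram L)" "card (conj_diagram L) = n"
    using diagramsD[OF L] by (simp_all add: conj_diagram_def card_image)
  ultimately show "conj_diagram L \<in> diagrams n"
    using diagramsD(3)[OF L] unfolding diagrams_def by blast
qed

lemma conj_tableau_conj_tableau [simp]: "conj_tableau (conj_tableau T) = T"
  by (simp add: conj_tableau_def fun_eq_iff)

lemma conj_diagram_conj_diagram [simp]: "conj_diagram (conj_diagram L) = L"
  by (simp add: conj_diagram_def image_image)

lemma conj_tableau_in_SYT:
  assumes T: "T \<in> SYT L"
  shows "conj_tableau T \<in> SYT (conj_diagram L)"
proof -
  have c: "card (conj_diagram L) = card L"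
    by (simp add: conj_diagram_def card_image)
  have m: "b \<in> conj_diagram L \<longleftrightarrow> prod.swap b \<in> L" for b
    unfolding conj_diagram_def by (metis imageE image_eqI swap_swap)
  have "bij_betw prod.swap (conj_diagram L) L"
    unfolding conj_diagram_def by (auto simp: bij_betw_def image_image)
  from bij_betw_trans[OF this SYT_bij[OF T]]
  show ?thesis
    using SYT_off[OF T] SYT_row[OF T] SYT_col[OF T] unfolding SYT_def conj_tableau_def
    by (auto simp: m c)
qed

lemma box_of_conj_tableau:
  assumes T: "T \<in> SYT L" and k: "k \<in> {1..card L}"
  shows "box_of (conj_tableau T) k = prod.swap (box_of T k)"
proof -
  note b = box_of_props[OF T k]
  have "conj_tableau T (prod.swap (box_of T k)) = k"
    using b by (simp add: conj_tableau_def)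
  moreover have "prod.swap (box_of T k) \<in> conj_diagram L"
    using b by (simp add: conj_diagram_def)
  ultimately show ?thesis
    using box_of_entry[OF conj_tableau_in_SYT[OF T]] by metis
qed

lemma content_conj_tableau:
  assumes "T \<in> SYT L" "k \<in> {1..card L}"
  shows "content (conj_tableau T) k = - content T k"
  by (simp add: content_def box_of_conj_tableau[OF assms])

lemma transpose_conj_tableau:
  "transpose k l \<circ> conj_tableau T = conj_tableau (transpose k l \<circ> T)"
  by (simp add: conj_tableau_def comp_assoc)

text \<open>\<open>R\<close> and the transpose of \<open>S\<close> have the same contents. This is
  what singles out the blocks with \<mu> conjugate to \<lambda>.\<close>

lemma opposite_contents:
  assumes L: "L \<in> diagrams n" and M: "M \<in> diagrams n" and S: "S \<in> SYT L" and R: "R \<in> SYT M"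
    and c: "\<And>k. k \<in> {1..n} \<Longrightarrow> content S k + content R k = 0"
  shows "M = conj_diagram L" "R = conj_tableau S"
proof -
  have "content R k = content (conj_tableau S) k" if "k \<in> {1..n}" for k
    using content_conj_tableau[OF S, of k] c[OF that] diagramsD(2)[OF L] that by simp
  from content_determines_tableau[OF M conj_diagram_in_diagrams[OF L] R conj_tableau_in_SYT[OF S] this]
  show "M = conj_diagram L" "R = conj_tableau S" by auto
qed

section \<open>Adjacent transpositions and signs of tableaux\<close>

text \<open>The map sending \<open>k\<close> to \<open>S (box_of T k)\<close> permutes
  \<open>{1..n}\<close>; without a descent it is strictly increasing, hence the identity.\<close>

lemma exists_descent:
  assumes L: "L \<in> diagrams n" and S: "S \<in> SYT L" and T: "T \<in> SYT L" and ne: "S \<noteq> T"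
  shows "\<exists>k\<in>{1..<n}. S (box_of T (k + 1)) < S (box_of T k)"
proof (rule ccontr)
  assume *: "\<not> ?thesis"
  have c: "card L = n" using diagramsD(2)[OF L] .
  have bS: "bij_betw S L {1..n}" using SYT_bij[OF S] c by simp
  have step: "S (box_of T k) < S (box_of T (k + 1))" if "k \<in> {1..<n}" for k
  proof -
    have k: "k \<in> {1..card L}" "k + 1 \<in> {1..card L}" using that c by auto
    note b = box_of_props[OF T k(1)] box_of_props[OF T k(2)]
    have "box_of T k \<noteq> box_of T (k + 1)" using b by auto
    then have "S (box_of T k) \<noteq> S (box_of T (k + 1))"
      using b bij_betw_imp_inj_on[OF bS] by (auto dest: inj_onD)
    with * that show ?thesis by force
  qed
  have rng: "S (box_of T k) \<in> {1..n}" if "k \<in> {1..n}" for k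
    using box_of_props(1)[OF T] bij_betwE[OF bS] that c by auto
  \<comment> \<open>Strict growth is used twice: counting up from 1 bounds the values from below,
    counting down from \<open>n\<close> bounds them from above.\<close>
  have lower: "k \<le> S (box_of T k)" if "k \<in> {1..n}" for k
    using that
  proof (induction k)
    case (Suc k)
    show ?case
    proof (cases "k = 0")
      case True
      then show ?thesis using rng[OF Suc.prems] by simp
    next
      case False
      then show ?thesis using Suc step[of k] by fastforce
    qed
  qed simp
  have upper: "S (box_of T (n - i)) + i \<le> n" if "i < n" for i
    using that
  proof (induction i)
    case 0
    then show ?case using rng[of n] by simp
  next
    case (Suc i)
    have "n - Suc i + 1 = n - i" using Suc.prems by simp
    then have "S (box_of T (n - Suc i)) < S (box_of T (n - i))"
      using step[of "n - Suc i"] Suc.prems by auto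
    then show ?case using Suc by simp
  qed
  have eq: "S (box_of T k) = k" if "k \<in> {1..n}" for k
    using lower[OF that] upper[of "n - k"] that by auto
  have "S b = T b" for b
  proof (cases "b \<in> L")
    case True
    then have "T b \<in> {1..n}" using bij_betwE[OF SYT_bij[OF T]] c by auto
    then show ?thesis using eq[of "T b"] box_of_entry[OF T True] by simp
  next
    case False
    then show ?thesis using SYT_off[OF T] SYT_off[OF S] by simp
  qed
  with ne show False by blast
qed

text \<open>The swap reverses the order of the entries \<open>k\<close> and \<open>k + 1\<close>
  only. Boxes in one row or column are ordered alike by \<open>S\<close> and \<open>T\<close>, so at
  a descent the boxes of \<open>k\<close> and \<open>k + 1\<close> share neither.\<close>

lemma transpose_tableau_in_SYT:
  assumes L: "L \<in> diagrams n" and S: "S \<in> SYT L" and T: "T \<in> SYT L"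
    and k: "k \<in> {1..<n}" and descent: "S (box_of T (k + 1)) < S (box_of T k)"
  shows "transpose k (k + 1) \<circ> T \<in> SYT L"
proof -
  let ?s = "transpose k (k + 1)"
  have c: "card L = n" using diagramsD(2)[OF L] .
  have "bij_betw ?s {1..n} {1..n}"
    using k by (intro permutes_imp_bij permutes_swap_id) auto
  then have bij: "bij_betw (?s \<circ> T) L {1..card L}"
    using bij_betw_trans[OF SYT_bij[OF T]] c by auto
  have lt: "(?s \<circ> T) a < (?s \<circ> T) b"
    if "a \<in> L" "b \<in> L" "T a < T b" "S a < S b" for a b
  proof -
    have "\<not> (T a = k \<and> T b = k + 1)"
      using box_of_entry[OF T that(1)] box_of_entry[OF T that(2)] descent that(4) by auto
    then show ?thesis
      using that(3) by (auto simp: transpose_def)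
  qed
  have off: "(?s \<circ> T) b = 0" if "b \<notin> L" for b
    using SYT_off[OF T that] k by (simp add: transpose_def)
  show ?thesis
    unfolding SYT_def mem_Collect_eq
  proof (intro conjI allI impI)
    fix i j j'
    assume "(i, j) \<in> L \<and> (i, j') \<in> L \<and> j < j'"
    then show "(?s \<circ> T) (i, j) < (?s \<circ> T) (i, j')"
      using lt SYT_row[OF T] SYT_row[OF S] by blast
  next
    fix i i' j
    assume "(i, j) \<in> L \<and> (i', j) \<in> L \<and> i < i'"
    then show "(?s \<circ> T) (i, j) < (?s \<circ> T) (i', j)"
      using lt SYT_col[OF T] SYT_col[OF S] by blast
  qed (use bij off in blast)+
qed

text \<open>
  If \<open>k\<close> is a descent of \<open>S \<circ> T\<^sup>-\<^sup>1\<close> then \<open>(k k+1)T\<close> is again standard and closer to \<open>S\<close>; the sum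
  below measures the distance.
\<close>

lemma SYT_transpose_induct [consumes 3, case_names base step]:
  assumes L: "L \<in> diagrams n" and S: "S \<in> SYT L" and T: "T \<in> SYT L"
    and base: "P S"
    and step: "\<And>T k. T \<in> SYT L \<Longrightarrow> k \<in> {1..<n} \<Longrightarrow> transpose k (k + 1) \<circ> T \<in> SYT L \<Longrightarrow>
                 P (transpose k (k + 1) \<circ> T) \<Longrightarrow> P T"
  shows "P T"
  using T
proof (induction "\<Sum>b\<in>L. T b * (n - S b)" arbitrary: T rule: less_induct)
  case less
  show ?case
  proof (cases "S = T")
    case True
    then show ?thesis using base by simp
  next
    case False
    then obtain k where k: "k \<in> {1..<n}" and d: "S (box_of T (k + 1)) < S (box_of T k)"
      using exists_descent[OF L S less.prems] by blast
    let ?T' = "transpose k (k + 1) \<circ> T"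
    have T': "?T' \<in> SYT L"
      using transpose_tableau_in_SYT[OF L S less.prems k d] .
    have c: "card L = n" and fin: "finite L" using diagramsD[OF L] by auto
    let ?a = "box_of T k" and ?b = "box_of T (k + 1)"
    have a: "?a \<in> L" "T ?a = k" and b: "?b \<in> L" "T ?b = k + 1"
      using box_of_props[OF less.prems, of k] box_of_props[OF less.prems, of "k + 1"] k c by auto
    have ab: "?a \<noteq> ?b" using a b by auto
    have Sn: "S ?a \<le> n"
      using bij_betwE[OF SYT_bij[OF S]] a c by auto
    have split: "(\<Sum>x\<in>L. f x) = f ?a + f ?b + (\<Sum>x\<in>L - {?a, ?b}. f x)" for f :: "_ \<Rightarrow> nat"
    proof -
      have "(\<Sum>x\<in>L. f x) = f ?a + (\<Sum>x\<in>L - {?a}. f x)"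
        using fin a by (simp add: sum.remove)
      also have "(\<Sum>x\<in>L - {?a}. f x) = f ?b + (\<Sum>x\<in>L - {?a} - {?b}. f x)"
        using fin b ab by (intro sum.remove) auto
      also have "L - {?a} - {?b} = L - {?a, ?b}" by auto
      finally show ?thesis by simp
    qed
    have "(\<Sum>x\<in>L - {?a, ?b}. ?T' x * (n - S x)) = (\<Sum>x\<in>L - {?a, ?b}. T x * (n - S x))"
    proof (rule sum.cong)
      fix x assume x: "x \<in> L - {?a, ?b}"
      then have "T x \<noteq> k" "T x \<noteq> k + 1"
        using box_of_entry[OF less.prems, of x] by auto
      then show "?T' x * (n - S x) = T x * (n - S x)" by (simp add: transpose_def)
    qed simp
    \<comment> \<open>The swap changes the sum by \<open>S ?b - S ?a\<close>, which is negative at a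
      descent. Subtraction is truncated, hence the bound \<open>Sn\<close>.\<close>
    moreover have "?T' ?a * (n - S ?a) + ?T' ?b * (n - S ?b) < T ?a * (n - S ?a) + T ?b * (n - S ?b)"
    proof -
      have "n - S ?a < n - S ?b"
        using d Sn by simp
      then show ?thesis
        by (simp add: a(2) b(2)[unfolded Suc_eq_plus1[symmetric]])
    qed
    ultimately have "(\<Sum>x\<in>L. ?T' x * (n - S x)) < (\<Sum>x\<in>L. T x * (n - S x))"
      unfolding split by simp
    then have "P ?T'" using less.hyps T' by blast
    then show ?thesis using step[OF less.prems k T'] by blast
  qed
qed

section \<open>Signs of tableaux under permutations\<close>

lemma tableau_sign_unique:
  assumes L: "L \<in> diagrams n" and T0: "T0 \<in> SYT L"
    and s: "\<sigma> permutes {1..n}" "\<sigma> \<circ> T0 = T"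
  shows "tableau_sign n T0 T = sign \<sigma>"
proof -
  \<comment> \<open>Every element of \<open>{1..n}\<close> is an entry of \<open>T0\<close>, so the
    permutation is determined by its effect on \<open>T0\<close>.\<close>
  have "\<tau> = \<sigma>" if "\<tau> permutes {1..n}" "\<tau> \<circ> T0 = T" for \<tau>
  proof
    fix x
    show "\<tau> x = \<sigma> x"
    proof (cases "x \<in> {1..n}")
      case True
      then have "T0 (box_of T0 x) = x"
        using box_of_props[OF T0] diagramsD(2)[OF L] by simp
      then show ?thesis
        using fun_cong[OF that(2), of "box_of T0 x"] fun_cong[OF s(2), of "box_of T0 x"] by simp
    next
      case False
      then show ?thesis
        using that(1) s(1) by (metis permutes_not_in)
    qed
  qed
  then have "(THE \<sigma>. \<sigma> permutes {1..n} \<and> \<sigma> \<circ> T0 = T) = \<sigma>"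
    using s by (intro the_equality conjI) blast+
  then show ?thesis by (simp add: tableau_sign_def)
qed

lemma tableau_permutation_exists:
  assumes L: "L \<in> diagrams n" and T0: "T0 \<in> SYT L" and T: "T \<in> SYT L"
  shows "\<exists>\<sigma>. \<sigma> permutes {1..n} \<and> \<sigma> \<circ> T0 = T"
  using L T0 T
proof (induction rule: SYT_transpose_induct)
  case base
  show ?case by (intro exI[of _ id] conjI permutes_id id_comp)
next
  case (step T k)
  then obtain \<sigma> where s: "\<sigma> permutes {1..n}" "\<sigma> \<circ> T0 = transpose k (k + 1) \<circ> T" by blast
  have "transpose k (k + 1) permutes {1..n}"
    using step by (intro permutes_swap_id) auto
  moreover have "(transpose k (k + 1) \<circ> \<sigma>) \<circ> T0 = T"
    unfolding comp_assoc s(2) by (simp add: fun_eq_iff)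
  ultimately show ?case
    using permutes_compose[OF s(1)] by blast
qed

lemma tableau_sign_self:
  assumes "L \<in> diagrams n" "T0 \<in> SYT L"
  shows "tableau_sign n T0 T0 = 1"
  using tableau_sign_unique[OF assms, of id T0] by simp

lemma tableau_sign_square:
  assumes "L \<in> diagrams n" "T0 \<in> SYT L" "T \<in> SYT L"
  shows "tableau_sign n T0 T * tableau_sign n T0 T = 1"
proof -
  obtain \<sigma> where "\<sigma> permutes {1..n}" "\<sigma> \<circ> T0 = T"
    using tableau_permutation_exists[OF assms] by blast
  then have "tableau_sign n T0 T = sign \<sigma>"
    using tableau_sign_unique[OF assms(1,2)] by blast
  then show ?thesis by simp
qed

lemma tableau_sign_transpose:
  assumes L: "L \<in> diagrams n" and T0: "T0 \<in> SYT L" and T: "T \<in> SYT L" and k: "k \<in> {1..<n}"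
  shows "tableau_sign n T0 (transpose k (k + 1) \<circ> T) = - tableau_sign n T0 T"
proof -
  obtain \<sigma> where s: "\<sigma> permutes {1..n}" "\<sigma> \<circ> T0 = T"
    using tableau_permutation_exists[OF L T0 T] by blast
  have t: "transpose k (k + 1) permutes {1..n}"
    using k by (intro permutes_swap_id) auto
  have "permutation \<sigma>" "permutation (transpose k (k + 1))"
    using s t permutation_permutes by blast+
  then have "sign (transpose k (k + 1) \<circ> \<sigma>) = - sign \<sigma>"
    by (simp add: sign_compose sign_swap_id)
  moreover have "tableau_sign n T0 (transpose k (k + 1) \<circ> T) = sign (transpose k (k + 1) \<circ> \<sigma>)"
    using permutes_compose[OF s(1) t] by (rule tableau_sign_unique[OF L T0]) (simp add: comp_assoc s(2))
  ultimately show ?thesis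
    using tableau_sign_unique[OF L T0 s] by simp
qed

section \<open>The Young-Yamanouchi representation on adjacent transpositions\<close>

lemma transpose_comp_transpose: "transpose k l \<circ> (transpose k l \<circ> T) = T"
  by (simp add: fun_eq_iff)

lemma transpose_tableau_neq:
  assumes L: "L \<in> diagrams n" and T: "T \<in> SYT L" and k: "k \<in> {1..<n}"
  shows "transpose k (k + 1) \<circ> T \<noteq> T"
proof
  assume *: "transpose k (k + 1) \<circ> T = T"
  have "T (box_of T k) = k"
    using box_of_props[OF T, of k] diagramsD(2)[OF L] k by simp
  then show False
    using fun_cong[OF *, of "box_of T k"] by simp
qed

lemma Sym_transpose: "k \<in> {1..<n} \<Longrightarrow> transpose k (k + 1) \<in> Sym n"
  unfolding Sym_def by (auto intro: permutes_swap_id)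

text \<open>Carries properties of the matrices from the adjacent transpositions, where they are
  prescribed, to all of \<open>S(n)\<close>.\<close>

lemma Sym_adjacent_induct [consumes 1, case_names id step]:
  assumes \<sigma>: "\<sigma> \<in> Sym n" and id: "P id"
    and step: "\<And>k \<sigma>. k \<in> {1..<n} \<Longrightarrow> \<sigma> \<in> Sym n \<Longrightarrow> P \<sigma> \<Longrightarrow> P (transpose k (k + 1) \<circ> \<sigma>)"
  shows "P \<sigma>"
proof -
  \<comment> \<open>Induction on the distance: \<open>(a b+1) = (b b+1)(a b)(b b+1)\<close>, with
    the distance 1 as the base case.\<close>
  have far: "P (transpose a (a + Suc m) \<circ> \<sigma>)"
    if "1 \<le> a" "a + Suc m \<le> n" "\<sigma> \<in> Sym n" "P \<sigma>" for a m \<sigma>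
    using that
  proof (induction m arbitrary: \<sigma>)
    case 0
    have "P (transpose a (a + 1) \<circ> \<sigma>)"
      using 0 by (intro step) auto
    then show ?case unfolding One_nat_def .
  next
    case (Suc m)
    let ?b = "a + Suc m"
    let ?s = "transpose ?b (?b + 1)"
    have b: "?b \<in> {1..<n}" using Suc.prems by simp
    have s: "?s permutes {1..n}" and t: "transpose a ?b permutes {1..n}"
      using Suc.prems by (auto intro!: permutes_swap_id)
    have 1: "?s \<circ> \<sigma> \<in> Sym n" "P (?s \<circ> \<sigma>)"
      using step[OF b Suc.prems(3,4)] permutes_compose[OF _ s] Suc.prems(3)
      by (auto simp: Sym_def)
    have 2: "transpose a ?b \<circ> (?s \<circ> \<sigma>) \<in> Sym n"
      using permutes_compose[OF _ t] 1(1) by (auto simp: Sym_def)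
    have "P (transpose a ?b \<circ> (?s \<circ> \<sigma>))"
      by (rule Suc.IH[OF _ _ 1]) (use Suc.prems in simp_all)
    from step[OF b 2 this]
    have "P (?s \<circ> (transpose a ?b \<circ> (?s \<circ> \<sigma>)))" .
    moreover have "?s \<circ> (transpose a ?b \<circ> (?s \<circ> \<sigma>)) = transpose a (a + Suc (Suc m)) \<circ> \<sigma>"
      by (auto simp: fun_eq_iff transpose_def)
    ultimately show ?case by metis
  qed
  have "\<sigma> permutes {1..n}" "finite {1..n}" using \<sigma> by (simp_all add: Sym_def)
  then show ?thesis
  proof (induction rule: permutes_induct)
    case (swap a b p)
    have *: "P (transpose a b \<circ> p)" if "a < b" "a \<in> {1..n}" "b \<in> {1..n}" for a b
    proof -
      have "b = a + Suc (b - a - 1)" using that by simp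
      moreover have "P (transpose a (a + Suc (b - a - 1)) \<circ> p)"
        using swap(4,5) that by (intro far) (auto simp: Sym_def)
      ultimately show ?thesis by metis
    qed
    show ?case
      using *[of a b] *[of b a] swap(1-3) by (metis linorder_neqE_nat transpose_commute)
  qed (rule id)
qed

lemma sign_transpose_comp:
  assumes "k \<in> {1..<n}" "\<sigma> \<in> Sym n"
  shows "sign (transpose k (k + 1) \<circ> \<sigma>) = - sign \<sigma>" "sign (\<sigma> \<circ> transpose k (k + 1)) = - sign \<sigma>"
proof -
  have "permutation \<sigma>" "permutation (transpose k (k + 1))"
    using assms(2) Sym_transpose[OF assms(1)] unfolding Sym_def
    by (auto intro: permutes_imp_permutation[of "{1..n}"])
  then show "sign (transpose k (k + 1) \<circ> \<sigma>) = - sign \<sigma>" "sign (\<sigma> \<circ> transpose k (k + 1)) = - sign \<sigma>"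
    by (simp_all add: sign_compose sign_swap_id)
qed

section \<open>Matrix entries on the generators\<close>

lemma young_yamanouchi_id:
  assumes "young_yamanouchi n L D" "S \<in> SYT L" "T \<in> SYT L"
  shows "D id S T = (if S = T then 1 else 0)"
  using assms unfolding young_yamanouchi_def mat_eq_def one_mat_def by blast

lemma young_yamanouchi_comp:
  assumes "young_yamanouchi n L D" "S \<in> SYT L" "T \<in> SYT L" "\<sigma> \<in> Sym n" "\<tau> \<in> Sym n"
  shows "D (\<sigma> \<circ> \<tau>) S T = (\<Sum>U\<in>SYT L. D \<sigma> S U * D \<tau> U T)"
  using assms unfolding young_yamanouchi_def mat_eq_def mat_prod_def by blast

lemma young_yamanouchi_transpose:
  assumes "young_yamanouchi n L D" "S \<in> SYT L" "T \<in> SYT L" "k \<in> {1..<n}"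
  shows "D (transpose k (k + 1)) S T =
    complex_of_real (1 / of_int (content T (k + 1) - content T k)) * ket T S +
    complex_of_real (sqrt (1 - 1 / (of_int (content T (k + 1) - content T k))\<^sup>2)) *
      ket (transpose k (k + 1) \<circ> T) S"
  using assms unfolding young_yamanouchi_def axial_distance_content Let_def by blast

lemma young_yamanouchi_involution:
  assumes "young_yamanouchi n L D" "S \<in> SYT L" "T \<in> SYT L" "k \<in> {1..<n}"
  shows "(\<Sum>U\<in>SYT L. D (transpose k (k + 1)) S U * D (transpose k (k + 1)) U T) =
    (if S = T then 1 else 0)"
  using young_yamanouchi_comp[OF assms(1-3) Sym_transpose[OF assms(4)] Sym_transpose[OF assms(4)]]
    young_yamanouchi_id[OF assms(1-3)] by simp

text \<open>The off-diagonal coefficient depends only on the square of the axial distance, and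
  passing from \<open>T\<close> to \<open>(k k+1)T\<close> merely changes the sign of that
  distance.\<close>

lemma young_yamanouchi_symmetric:
  assumes L: "L \<in> diagrams n" and D: "young_yamanouchi n L D"
    and S: "S \<in> SYT L" and T: "T \<in> SYT L" and k: "k \<in> {1..<n}"
  shows "D (transpose k (k + 1)) S T = D (transpose k (k + 1)) T S"
proof -
  let ?s = "transpose k (k + 1)"
  consider "S = T" | "S \<noteq> T" "S = ?s \<circ> T" | "S \<noteq> T" "S \<noteq> ?s \<circ> T" by blast
  then show ?thesis
  proof cases
    case 2
    then have T_eq: "T = ?s \<circ> S"
      using transpose_comp_transpose by metis
    have c: "content S k = content T (k + 1)" "content S (k + 1) = content T k"
      using content_transpose[OF L T _ k] S 2(2) by auto
    have kets: "ket T S = 0" "ket (?s \<circ> T) S = 1" "ket S T = 0" "ket (?s \<circ> S) T = 1"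
      using 2 T_eq by (metis ket_def)+
    show ?thesis
      unfolding young_yamanouchi_transpose[OF D S T k] young_yamanouchi_transpose[OF D T S k] c kets
      by (simp add: power2_commute)
  next
    case 3
    then have "T \<noteq> ?s \<circ> S"
      using transpose_comp_transpose by metis
    with 3 show ?thesis
      unfolding young_yamanouchi_transpose[OF D S T k] young_yamanouchi_transpose[OF D T S k]
      by (simp add: ket_def)
  qed simp
qed

text \<open>
  The defining relation \<open>s\<^sub>k X\<^bsub>k+1\<^esub> = X\<^sub>k s\<^sub>k + 1\<close> of the Jucys-Murphy elements, whose
  eigenvalues on \<open>|T\<rangle>\<close> are the contents.
\<close>

lemma young_yamanouchi_content:
  assumes L: "L \<in> diagrams n" and D: "young_yamanouchi n L D"
    and S: "S \<in> SYT L" and T: "T \<in> SYT L" and k: "k \<in> {1..<n}"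
  shows "D (transpose k (k + 1)) S T * of_int (content T (k + 1) - content S k) =
    (if S = T then 1 else 0)"
proof -
  let ?s = "transpose k (k + 1)"
  have neq: "content T (k + 1) \<noteq> content T k"
    using content_Suc_neq[OF L T k] .
  consider "S = T" | "S \<noteq> T" "S = ?s \<circ> T" | "S \<noteq> T" "S \<noteq> ?s \<circ> T" by blast
  then show ?thesis
  proof cases
    case 1
    have "(of_int (content T (k + 1) - content T k) :: complex) \<noteq> 0"
      using neq unfolding of_int_eq_0_iff by simp
    with 1 transpose_tableau_neq[OF L T k] show ?thesis
      unfolding young_yamanouchi_transpose[OF D S T k]
      by (auto simp: ket_def)
  next
    \<comment> \<open>Here the content difference is 0, because \<open>S\<close> has
      \<open>k\<close> in the box where \<open>T\<close> has \<open>k + 1\<close>.\<close>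
    case 2
    then show ?thesis
      using content_transpose[OF L T _ k] S by auto
  next
    case 3
    then show ?thesis
      unfolding young_yamanouchi_transpose[OF D S T k] by (simp add: ket_def)
  qed
qed

text \<open>The axial distance is at least 2 in absolute value, so the square root does not vanish.
  This permits cancelling the entry when coefficients are compared along a chain of
  tableaux.\<close>

lemma young_yamanouchi_off_diagonal:
  assumes L: "L \<in> diagrams n" and D: "young_yamanouchi n L D"
    and T: "T \<in> SYT L" and k: "k \<in> {1..<n}" and T': "transpose k (k + 1) \<circ> T \<in> SYT L"
  shows "D (transpose k (k + 1)) (transpose k (k + 1) \<circ> T) T \<noteq> 0"
proof -
  let ?c = "real_of_int (content T (k + 1) - content T k)"
  have "\<bar>?c\<bar> \<ge> 2"
    using abs_content_diff_ge_2[OF L T T' k] by linarith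
  then have "?c\<^sup>2 \<ge> 2\<^sup>2"
    by (metis abs_le_square_iff abs_numeral)
  then have "1 - 1 / ?c\<^sup>2 \<noteq> 0"
    by (auto simp: field_simps)
  then show ?thesis
    using transpose_tableau_neq[OF L T k]
    unfolding young_yamanouchi_transpose[OF D T' T k]
    by (auto simp: ket_def)
qed

text \<open>Transposing negates axial distances: the diagonal entry changes sign, the off-diagonal
  one does not. The product of the tableau signs is 1 in the first case and -1 in the
  second.\<close>

lemma young_yamanouchi_conj:
  assumes L: "L \<in> diagrams n" and D: "young_yamanouchi n L D"
    and E: "young_yamanouchi n (conj_diagram L) E" and T0: "T0 \<in> SYT L"
    and S: "S \<in> SYT L" and T: "T \<in> SYT L" and k: "k \<in> {1..<n}"
  shows "E (transpose k (k + 1)) (conj_tableau S) (conj_tableau T) =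
    - of_int (tableau_sign n T0 S * tableau_sign n T0 T) * D (transpose k (k + 1)) S T"
proof -
  let ?s = "transpose k (k + 1)"
  have inj: "conj_tableau A = conj_tableau B \<longleftrightarrow> A = B" for A B
    using conj_tableau_conj_tableau by metis
  have c: "content (conj_tableau T) k = - content T k"
    "content (conj_tableau T) (k + 1) = - content T (k + 1)"
    using content_conj_tableau[OF T] diagramsD(2)[OF L] k by auto
  have flip: "real_of_int (- x - - y) = - real_of_int (x - y)" for x y by simp
  have E_eq: "E ?s (conj_tableau S) (conj_tableau T) =
    - complex_of_real (1 / of_int (content T (k + 1) - content T k)) * ket T S +
    complex_of_real (sqrt (1 - 1 / (of_int (content T (k + 1) - content T k))\<^sup>2)) *
      ket (?s \<circ> T) S"
    unfolding young_yamanouchi_transpose[OF E conj_tableau_in_SYT[OF S] conj_tableau_in_SYT[OF T] k]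
      c flip transpose_conj_tableau ket_def inj
    by (simp only: power2_minus divide_minus_right of_real_minus)
  consider "S = T" | "S \<noteq> T" "S = ?s \<circ> T" | "S \<noteq> T" "S \<noteq> ?s \<circ> T" by blast
  then show ?thesis
  proof cases
    case 1
    then show ?thesis
      using transpose_tableau_neq[OF L T k] tableau_sign_square[OF L T0 T]
      unfolding E_eq young_yamanouchi_transpose[OF D S T k]
      by (simp add: ket_def)
  next
    case 2
    have "tableau_sign n T0 S * tableau_sign n T0 T = -1"
      using tableau_sign_square[OF L T0 T] tableau_sign_transpose[OF L T0 T k] 2(2) by simp
    with 2 show ?thesis
      unfolding E_eq young_yamanouchi_transpose[OF D S T k]
      by (simp add: ket_def)
  next
    case 3
    then show ?thesis
      unfolding E_eq young_yamanouchi_transpose[OF D S T k] by (simp add: ket_def)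
  qed
qed

section \<open>Propagation of opposite eigenvalues, in abstract form\<close>

lemma involution_apply:
  fixes A :: "'i \<Rightarrow> 'i \<Rightarrow> complex"
  assumes I: "finite I"
    and A2: "\<And>i j. i \<in> I \<Longrightarrow> j \<in> I \<Longrightarrow> (\<Sum>k\<in>I. A i k * A k j) = (if i = j then 1 else 0)"
    and w: "\<And>i. i \<in> I \<Longrightarrow> (\<Sum>k\<in>I. A i k * w k) = u i" and i: "i \<in> I"
  shows "(\<Sum>k\<in>I. A i k * u k) = w i"
proof -
  have "(\<Sum>k\<in>I. A i k * u k) = (\<Sum>k\<in>I. A i k * (\<Sum>j\<in>I. A k j * w j))"
    using w by simp
  also have "\<dots> = (\<Sum>k\<in>I. \<Sum>j\<in>I. A i k * A k j * w j)"
    by (simp add: sum_distrib_left mult.assoc)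
  also have "\<dots> = (\<Sum>j\<in>I. (\<Sum>k\<in>I. A i k * A k j) * w j)"
    by (subst sum.swap) (simp add: sum_distrib_right)
  also have "\<dots> = (\<Sum>j\<in>I. if i = j then w j else 0)"
    using A2[OF i] by (intro sum.cong) auto
  finally show ?thesis
    using I i by simp
qed

text \<open>
  The functions \<open>x\<close>, \<open>x'\<close> and \<open>y\<close>, \<open>y'\<close> are the diagonals of the Jucys-Murphy elements
  \<open>X\<^sub>k\<close>, \<open>X\<^bsub>k+1\<^esub>\<close> in the two representations.
\<close>

lemma opposite_eigenvalues_step:
  fixes A :: "'i \<Rightarrow> 'i \<Rightarrow> complex" and B :: "'j \<Rightarrow> 'j \<Rightarrow> complex"
  assumes I: "finite I" and J: "finite J"
    and A2: "\<And>i j. i \<in> I \<Longrightarrow> j \<in> I \<Longrightarrow> (\<Sum>k\<in>I. A i k * A k j) = (if i = j then 1 else 0)"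
    and AB: "\<And>i j. i \<in> I \<Longrightarrow> j \<in> J \<Longrightarrow>
               (\<Sum>i'\<in>I. A i i' * v i' j) = - (\<Sum>j'\<in>J. B j j' * v i j')"
    and AX: "\<And>i i'. i \<in> I \<Longrightarrow> i' \<in> I \<Longrightarrow> A i i' * (x' i' - x i) = (if i = i' then 1 else 0)"
    and BY: "\<And>j j'. j \<in> J \<Longrightarrow> j' \<in> J \<Longrightarrow> B j j' * (y' j - y j') = (if j = j' then 1 else 0)"
    and XY: "\<And>i j. i \<in> I \<Longrightarrow> j \<in> J \<Longrightarrow> (x i + y j) * v i j = 0"
    and i: "i \<in> I" and j: "j \<in> J"
  shows "(x' i + y' j) * v i j = 0"
proof -
  \<comment> \<open>As \<open>A\<close> is invertible, it suffices that it annihilates the vector.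
    By \<open>AX\<close>, replacing \<open>x'\<close> by \<open>x\<close> leaves a remainder
    \<open>v\<close>; \<open>AB\<close> then trades \<open>A\<close> for \<open>-B\<close>, and by
    \<open>BY\<close> replacing \<open>y'\<close> by \<open>y\<close> leaves a remainder
    \<open>-v\<close>. The remainders cancel and \<open>XY\<close> kills the rest.\<close>
  have "(\<Sum>i'\<in>I. A i i' * ((x' i' + y' j) * v i' j)) = 0" if i: "i \<in> I" for i
  proof -
    have "(\<Sum>i'\<in>I. A i i' * ((x' i' + y' j) * v i' j)) =
      (\<Sum>i'\<in>I. A i i' * (x' i' - x i) * v i' j + (x i + y' j) * (A i i' * v i' j))"
      by (simp add: algebra_simps)
    also have "\<dots> = (\<Sum>i'\<in>I. A i i' * (x' i' - x i) * v i' j) +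
        (x i + y' j) * (\<Sum>i'\<in>I. A i i' * v i' j)"
      by (simp add: sum.distrib sum_distrib_left)
    also have "(\<Sum>i'\<in>I. A i i' * (x' i' - x i) * v i' j) = (\<Sum>i'\<in>I. if i = i' then v i' j else 0)"
      using AX[OF i] by (intro sum.cong) auto
    also have "\<dots> = v i j"
      using I i by simp
    also have "(x i + y' j) * (\<Sum>i'\<in>I. A i i' * v i' j) =
        - (\<Sum>j'\<in>J. B j j' * ((x i + y' j) * v i j'))"
      unfolding AB[OF i j] by (simp add: sum_distrib_left mult_ac)
    also have "(\<Sum>j'\<in>J. B j j' * ((x i + y' j) * v i j')) =
        (\<Sum>j'\<in>J. if j = j' then v i j' else 0)"
    proof (rule sum.cong)
      fix j' assume j': "j' \<in> J"
      have "B j j' * ((x i + y' j) * v i j') =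
          B j j' * ((x i + y j') * v i j') + B j j' * (y' j - y j') * v i j'"
        by (simp add: algebra_simps)
      then show "B j j' * ((x i + y' j) * v i j') = (if j = j' then v i j' else 0)"
        unfolding XY[OF i j'] BY[OF j j'] by (cases "j = j'") simp_all
    qed simp
    also have "\<dots> = v i j"
      using J j by simp
    finally show ?thesis by simp
  qed
  from involution_apply[OF I A2 this i]
  show ?thesis by simp
qed

section \<open>Alternating vectors in a product of two representations\<close>

text \<open>For representations \<open>D\<close> and \<open>E\<close> this says that
  \<open>S(n)\<close> acts on \<open>v\<close> by the sign character; the condition is imposed on
  generators only.\<close>

definition alternating ::
    "nat \<Rightarrow> diagram \<Rightarrow> diagram \<Rightarrow> ((nat \<Rightarrow> nat) \<Rightarrow> (tableau, tableau) cmat) \<Rightarrow>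
     ((nat \<Rightarrow> nat) \<Rightarrow> (tableau, tableau) cmat) \<Rightarrow> (tableau \<Rightarrow> tableau \<Rightarrow> complex) \<Rightarrow> bool" where
  "alternating n L M D E v \<longleftrightarrow> (\<forall>k\<in>{1..<n}. \<forall>S\<in>SYT L. \<forall>R\<in>SYT M.
     (\<Sum>S'\<in>SYT L. \<Sum>R'\<in>SYT M.
        D (transpose k (k + 1)) S S' * E (transpose k (k + 1)) R R' * v S' R') = - v S R)"

text \<open>Since \<open>D\<close> maps the transposition to an involution, that factor can be moved
  to the other side of the defining equation.\<close>

lemma alternating_one_sided:
  assumes L: "L \<in> diagrams n" and D: "young_yamanouchi n L D"
    and v: "alternating n L M D E v" and k: "k \<in> {1..<n}" and S: "S \<in> SYT L" and R: "R \<in> SYT M"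
  shows "(\<Sum>S'\<in>SYT L. D (transpose k (k + 1)) S S' * v S' R) =
    - (\<Sum>R'\<in>SYT M. E (transpose k (k + 1)) R R' * v S R')"
proof -
  let ?A = "D (transpose k (k + 1))" and ?B = "E (transpose k (k + 1))"
  have "(\<Sum>S'\<in>SYT L. ?A S S' * (\<Sum>R'\<in>SYT M. ?B R R' * v S' R')) = - v S R" if "S \<in> SYT L" for S
    using v k that R unfolding alternating_def
    by (simp add: sum_distrib_left mult.assoc)
  from involution_apply[OF finite_SYT[OF L] young_yamanouchi_involution[OF D _ _ k] this S]
  have "(\<Sum>S'\<in>SYT L. ?A S S' * - v S' R) = (\<Sum>R'\<in>SYT M. ?B R R' * v S R')" .
  then have "- (\<Sum>S'\<in>SYT L. ?A S S' * v S' R) = (\<Sum>R'\<in>SYT M. ?B R R' * v S R')"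
    by (simp add: sum_negf)
  then show ?thesis
    by (metis minus_minus)
qed

text \<open>Induction on \<open>k\<close> through \<open>opposite_eigenvalues_step\<close>: only the
  diagonals of the Jucys-Murphy elements enter, never the elements themselves.\<close>

lemma alternating_content:
  assumes L: "L \<in> diagrams n" and M: "M \<in> diagrams n"
    and D: "young_yamanouchi n L D" and E: "young_yamanouchi n M E"
    and v: "alternating n L M D E v"
    and "k \<in> {1..n}" "S \<in> SYT L" "R \<in> SYT M"
  shows "of_int (content S k + content R k) * v S R = 0"
  using assms(6-)
proof (induction k arbitrary: S R)
  case (Suc k)
  show ?case
  proof (cases "k = 0")
    case True
    \<comment> \<open>The induction really starts at 1, whose box is the corner
      \<open>(0, 0)\<close> in every standard tableau.\<close>
    have first: "content T 1 = 0" if "N \<in> diagrams n" "T \<in> SYT N" for N T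
    proof -
      obtain i j where b: "box_of T 1 = (i, j)" by (meson surj_pair)
      have c: "card N = n" using diagramsD(2)[OF that(1)] .
      have in_N: "(i, j) \<in> N" and T1: "T (i, j) = 1"
        using box_of_props[OF that(2), of 1] Suc.prems(1) c b by auto
      have "(0, 0) \<in> N"
        using diagramsD(3)[OF that(1) in_N] by auto
      then have "1 \<le> T (0, 0)"
        using bij_betwE[OF SYT_bij[OF that(2)]] by auto
      then have "(0, 0) = (i, j)"
        using SYT_mono[OF that(1,2) in_N, of 0 0] T1 by fastforce
      with b show ?thesis by (simp add: content_def)
    qed
    show ?thesis
      using first[OF L Suc.prems(2)] first[OF M Suc.prems(3)] True by simp
  next
    case False
    then have k: "k \<in> {1..<n}" "k \<in> {1..n}" using Suc.prems(1) by auto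
    let ?A = "D (transpose k (k + 1))" and ?B = "E (transpose k (k + 1))"
    have "(of_int (content S (k + 1)) + of_int (content R (k + 1))) * v S R = 0"
    proof (rule opposite_eigenvalues_step[where I = "SYT L" and J = "SYT M" and A = ?A and B = ?B
          and x = "\<lambda>S. of_int (content S k)" and y = "\<lambda>S. of_int (content S k)"])
      show "(\<Sum>U\<in>SYT L. ?A S U * ?A U T) = (if S = T then 1 else 0)"
        if "S \<in> SYT L" "T \<in> SYT L" for S T
        using young_yamanouchi_involution[OF D that k(1)] .
      show "(\<Sum>S'\<in>SYT L. ?A S S' * v S' R) = - (\<Sum>R'\<in>SYT M. ?B R R' * v S R')"
        if "S \<in> SYT L" "R \<in> SYT M" for S R
        using alternating_one_sided[OF L D v k(1) that] .
      show "?A S T * (of_int (content T (k + 1)) - of_int (content S k)) = (if S = T then 1 else 0)"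
        if "S \<in> SYT L" "T \<in> SYT L" for S T
        using young_yamanouchi_content[OF L D that k(1)] by simp
      \<comment> \<open>The second factor needs the content relation in transposed form, hence the
        appeal to symmetry.\<close>
      show "?B S T * (of_int (content S (k + 1)) - of_int (content T k)) = (if S = T then 1 else 0)"
        if "S \<in> SYT M" "T \<in> SYT M" for S T
        using young_yamanouchi_content[OF M E that(2,1) k(1)]
          young_yamanouchi_symmetric[OF M E that k(1)] by auto
      show "(of_int (content S k) + of_int (content R k)) * v S R = 0"
        if "S \<in> SYT L" "R \<in> SYT M" for S R
        using Suc.IH[OF k(2) that] by simp
    qed (use finite_SYT L M Suc.prems in blast)+
    then show ?thesis by simp
  qed
qed simp

text \<open>Alternating vectors form a space of dimension at most one: contents fix the support, and
  the chain of adjacent swaps from \<open>T0\<close> fixes all ratios of coefficients.\<close>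

lemma alternating_form:
  assumes L: "L \<in> diagrams n" and M: "M \<in> diagrams n"
    and D: "young_yamanouchi n L D" and E: "young_yamanouchi n M E"
    and v: "alternating n L M D E v" and T0: "T0 \<in> SYT L"
    and S: "S \<in> SYT L" and R: "R \<in> SYT M"
  shows "v S R = (if M = conj_diagram L \<and> R = conj_tableau S
    then of_int (tableau_sign n T0 S) * v T0 (conj_tableau T0) else 0)"
proof -
  have zero: "v S R = 0" if "S \<in> SYT L" "R \<in> SYT M" "\<not> (M = conj_diagram L \<and> R = conj_tableau S)"
    for S R
  proof (rule ccontr)
    assume nz: "v S R \<noteq> 0"
    have "content S k + content R k = 0" if k: "k \<in> {1..n}" for k
    proof -
      have "(of_int (content S k + content R k) :: complex) = 0"
        using alternating_content[OF L M D E v k \<open>S \<in> SYT L\<close> \<open>R \<in> SYT M\<close>] nz by simp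
      then show ?thesis
        unfolding of_int_eq_0_iff .
    qed
    from opposite_contents[OF L M that(1,2) this] that(3) show False by blast
  qed
  show ?thesis
  proof (cases "M = conj_diagram L \<and> R = conj_tableau S")
    case False
    then show ?thesis using zero[OF S R False] by auto
  next
    case True
    then have M_eq: "M = conj_diagram L" by blast
    note fin = finite_SYT[OF L] finite_SYT[OF M]
    have "v T (conj_tableau T) = of_int (tableau_sign n T0 T) * v T0 (conj_tableau T0)"
      if "T \<in> SYT L" for T
      using L T0 that
    proof (induction rule: SYT_transpose_induct)
      case base
      then show ?case using tableau_sign_self[OF L T0] by simp
    next
      case (step T k)
      let ?s = "transpose k (k + 1)"
      let ?U = "?s \<circ> T"
      have cT: "conj_tableau T \<in> SYT M" and cU: "conj_tableau ?U \<in> SYT M"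
        using conj_tableau_in_SYT step(1,3) unfolding M_eq by blast+
      have inj: "conj_tableau A = conj_tableau B \<longleftrightarrow> A = B" for A B
        using conj_tableau_conj_tableau by metis
      \<comment> \<open>The one-sided relation is read off at the mixed position
        \<open>(?U, conj_tableau T)\<close>. There each side has a single term in the support, and
        these two terms link the coefficients of \<open>T\<close> and \<open>?U\<close>.\<close>
      have 1: "(\<Sum>S'\<in>SYT L. D ?s ?U S' * v S' (conj_tableau T)) = D ?s ?U T * v T (conj_tableau T)"
      proof -
        have "(\<Sum>S'\<in>SYT L. D ?s ?U S' * v S' (conj_tableau T)) =
            (\<Sum>S'\<in>SYT L. if S' = T then D ?s ?U T * v T (conj_tableau T) else 0)"
          using zero[OF _ cT] inj by (intro sum.cong) auto
        then show ?thesis using fin step(1) by simp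
      qed
      have 2: "(\<Sum>R'\<in>SYT M. E ?s (conj_tableau T) R' * v ?U R') =
          E ?s (conj_tableau T) (conj_tableau ?U) * v ?U (conj_tableau ?U)"
      proof -
        have "(\<Sum>R'\<in>SYT M. E ?s (conj_tableau T) R' * v ?U R') =
            (\<Sum>R'\<in>SYT M. if R' = conj_tableau ?U
               then E ?s (conj_tableau T) (conj_tableau ?U) * v ?U (conj_tableau ?U) else 0)"
          using zero[OF step(3)] by (intro sum.cong) auto
        then show ?thesis using fin cU by simp
      qed
      have sgn: "tableau_sign n T0 T * tableau_sign n T0 ?U = -1"
        using tableau_sign_square[OF L T0 step(1)] tableau_sign_transpose[OF L T0 step(1,2)] by simp
      have 3: "E ?s (conj_tableau T) (conj_tableau ?U) = D ?s ?U T"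
        unfolding young_yamanouchi_conj[OF L D E[unfolded M_eq] T0 step(1,3,2)] sgn
          young_yamanouchi_symmetric[OF L D step(1,3,2)] by simp
      have "v T (conj_tableau T) = - v ?U (conj_tableau ?U)"
        using alternating_one_sided[OF L D v step(2,3) cT] young_yamanouchi_off_diagonal[OF L D step(1-3)]
        unfolding 1 2 3 by (simp flip: mult_minus_right)
      then show ?case
        unfolding step(4) tableau_sign_transpose[OF L T0 step(1,2)] by simp
    qed
    then show ?thesis using True S by simp
  qed
qed

section \<open>The antisymmetric projector on a block\<close>

text \<open>Matrix entry of the antisymmetric projector on a pair of blocks, with the unitary parts,
  on which it is the identity, left out.\<close>

definition sign_block ::
    "nat \<Rightarrow> ((nat \<Rightarrow> nat) \<Rightarrow> (tableau, tableau) cmat) \<Rightarrow> ((nat \<Rightarrow> nat) \<Rightarrow> (tableau, tableau) cmat) \<Rightarrow>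
     tableau \<Rightarrow> tableau \<Rightarrow> tableau \<Rightarrow> tableau \<Rightarrow> complex" where
  "sign_block n D E S R S' R' =
     1 / fact n * (\<Sum>\<sigma>\<in>Sym n. of_int (sign \<sigma>) * (D \<sigma> S S' * E \<sigma> R R'))"

text \<open>Separates the two tensor factors under the average, so that the composition law applies
  to each of them.\<close>

lemma sum_sum_sign_block:
  "(\<Sum>S1\<in>I. \<Sum>R1\<in>J. a S1 * b R1 * (1 / fact n * (\<Sum>\<sigma>\<in>K. s \<sigma> * (f \<sigma> S1 * g \<sigma> R1)))) =
   1 / fact n * (\<Sum>\<sigma>\<in>K. s \<sigma> * ((\<Sum>S1\<in>I. a S1 * f \<sigma> S1) * (\<Sum>R1\<in>J. b R1 * g \<sigma> R1)) :: complex)"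
proof -
  have "(\<Sum>S1\<in>I. \<Sum>R1\<in>J. a S1 * b R1 * (1 / fact n * (\<Sum>\<sigma>\<in>K. s \<sigma> * (f \<sigma> S1 * g \<sigma> R1)))) =
    (\<Sum>S1\<in>I. \<Sum>R1\<in>J. \<Sum>\<sigma>\<in>K. 1 / fact n * (s \<sigma> * ((a S1 * f \<sigma> S1) * (b R1 * g \<sigma> R1))))"
    by (simp add: sum_distrib_left mult_ac)
  also have "\<dots> = (\<Sum>S1\<in>I. \<Sum>\<sigma>\<in>K. \<Sum>R1\<in>J. 1 / fact n * (s \<sigma> * ((a S1 * f \<sigma> S1) * (b R1 * g \<sigma> R1))))"
    by (intro sum.cong refl sum.swap)
  also have "\<dots> = (\<Sum>\<sigma>\<in>K. \<Sum>S1\<in>I. \<Sum>R1\<in>J. 1 / fact n * (s \<sigma> * ((a S1 * f \<sigma> S1) * (b R1 * g \<sigma> R1))))"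
    by (rule sum.swap)
  also have "\<dots> = 1 / fact n * (\<Sum>\<sigma>\<in>K. s \<sigma> * ((\<Sum>S1\<in>I. a S1 * f \<sigma> S1) * (\<Sum>R1\<in>J. b R1 * g \<sigma> R1)))"
    unfolding sum_product by (simp only: sum_distrib_left)
  finally show ?thesis .
qed

text \<open>Replacing \<sigma> by \<open>?s \<circ> \<sigma>\<close> permutes the summands of the
  average and reverses all signs.\<close>

lemma sign_block_alternating_left:
  assumes D: "young_yamanouchi n L D" and E: "young_yamanouchi n M E"
    and S': "S' \<in> SYT L" and R': "R' \<in> SYT M"
  shows "alternating n L M D E (\<lambda>S R. sign_block n D E S R S' R')"
  unfolding alternating_def
proof (intro ballI)
  fix k S R assume k: "k \<in> {1..<n}" and S: "S \<in> SYT L" and R: "R \<in> SYT M"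
  let ?s = "transpose k (k + 1)"
  note s = Sym_transpose[OF k]
  have "(\<Sum>S1\<in>SYT L. \<Sum>R1\<in>SYT M. D ?s S S1 * E ?s R R1 * sign_block n D E S1 R1 S' R') =
    1 / fact n * (\<Sum>\<sigma>\<in>Sym n. of_int (sign \<sigma>) *
      ((\<Sum>S1\<in>SYT L. D ?s S S1 * D \<sigma> S1 S') * (\<Sum>R1\<in>SYT M. E ?s R R1 * E \<sigma> R1 R')))"
    unfolding sign_block_def by (rule sum_sum_sign_block)
  also have "\<dots> = 1 / fact n * (\<Sum>\<sigma>\<in>Sym n. of_int (sign \<sigma>) * (D (?s \<circ> \<sigma>) S S' * E (?s \<circ> \<sigma>) R R'))"
    using young_yamanouchi_comp[OF D S S' s] young_yamanouchi_comp[OF E R R' s] by simp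
  also have "\<dots> = 1 / fact n *
      (\<Sum>\<sigma>\<in>Sym n. - of_int (sign (?s \<circ> \<sigma>)) * (D (?s \<circ> \<sigma>) S S' * E (?s \<circ> \<sigma>) R R'))"
    using sign_transpose_comp(1)[OF k] by simp
  also have "\<dots> = 1 / fact n * (\<Sum>\<sigma>\<in>Sym n. - of_int (sign \<sigma>) * (D \<sigma> S S' * E \<sigma> R R'))"
    using s setum_permutations_compose_left[of ?s "{1..n}"
        "\<lambda>\<sigma>. - of_int (sign \<sigma>) * (D \<sigma> S S' * E \<sigma> R R')"]
    unfolding Sym_def by simp
  also have "\<dots> = - sign_block n D E S R S' R'"
    by (simp add: sign_block_def sum_negf)
  finally show "(\<Sum>S1\<in>SYT L. \<Sum>R1\<in>SYT M. D ?s S S1 * E ?s R R1 * sign_block n D E S1 R1 S' R') =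
    - sign_block n D E S R S' R'" .
qed

text \<open>Here the second index pair varies and the transposition is composed on the right;
  symmetry of the generators turns its rows into the columns this requires.\<close>

lemma sign_block_alternating_right:
  assumes L: "L \<in> diagrams n" and M: "M \<in> diagrams n"
    and D: "young_yamanouchi n L D" and E: "young_yamanouchi n M E"
    and S: "S \<in> SYT L" and R: "R \<in> SYT M"
  shows "alternating n L M D E (\<lambda>S' R'. sign_block n D E S R S' R')"
  unfolding alternating_def
proof (intro ballI)
  fix k S' R' assume k: "k \<in> {1..<n}" and S': "S' \<in> SYT L" and R': "R' \<in> SYT M"
  let ?s = "transpose k (k + 1)"
  note s = Sym_transpose[OF k]
  have "(\<Sum>S1\<in>SYT L. \<Sum>R1\<in>SYT M. D ?s S' S1 * E ?s R' R1 * sign_block n D E S R S1 R1) =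
    1 / fact n * (\<Sum>\<sigma>\<in>Sym n. of_int (sign \<sigma>) *
      ((\<Sum>S1\<in>SYT L. D ?s S' S1 * D \<sigma> S S1) * (\<Sum>R1\<in>SYT M. E ?s R' R1 * E \<sigma> R R1)))"
    unfolding sign_block_def by (rule sum_sum_sign_block)
  also have "\<dots> = 1 / fact n * (\<Sum>\<sigma>\<in>Sym n. of_int (sign \<sigma>) * (D (\<sigma> \<circ> ?s) S S' * E (\<sigma> \<circ> ?s) R R'))"
    using young_yamanouchi_comp[OF D S S' _ s] young_yamanouchi_comp[OF E R R' _ s]
      young_yamanouchi_symmetric[OF L D S' _ k] young_yamanouchi_symmetric[OF M E R' _ k]
    by (simp add: mult.commute)
  also have "\<dots> = 1 / fact n *
      (\<Sum>\<sigma>\<in>Sym n. - of_int (sign (\<sigma> \<circ> ?s)) * (D (\<sigma> \<circ> ?s) S S' * E (\<sigma> \<circ> ?s) R R'))"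
    using sign_transpose_comp(2)[OF k] by simp
  also have "\<dots> = 1 / fact n * (\<Sum>\<sigma>\<in>Sym n. - of_int (sign \<sigma>) * (D \<sigma> S S' * E \<sigma> R R'))"
    using s sum_permutations_compose_right[of ?s "{1..n}"
        "\<lambda>\<sigma>. - of_int (sign \<sigma>) * (D \<sigma> S S' * E \<sigma> R R')"]
    unfolding Sym_def by simp
  also have "\<dots> = - sign_block n D E S R S' R'"
    by (simp add: sign_block_def sum_negf)
  finally show "(\<Sum>S1\<in>SYT L. \<Sum>R1\<in>SYT M. D ?s S' S1 * E ?s R' R1 * sign_block n D E S R S1 R1) =
    - sign_block n D E S R S' R'" .
qed

text \<open>The generators are symmetric involutions, so by induction the transpose of
  \<open>D \<sigma>\<close> is \<open>D (inv \<sigma>)\<close>; hence no complex conjugates.\<close>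

lemma young_yamanouchi_orthogonal:
  assumes L: "L \<in> diagrams n" and D: "young_yamanouchi n L D"
    and \<sigma>: "\<sigma> \<in> Sym n" and S: "S \<in> SYT L"
  shows "(\<Sum>T\<in>SYT L. D \<sigma> S T * D \<sigma> S T) = 1"
proof -
  have inv_Sym: "inv \<tau> \<in> Sym n" if "\<tau> \<in> Sym n" for \<tau>
    using that permutes_inv by (simp add: Sym_def)
  have transposed: "D \<sigma> S T = D (inv \<sigma>) T S" if "S \<in> SYT L" "T \<in> SYT L" for S T
    using \<sigma> that
  proof (induction arbitrary: S T rule: Sym_adjacent_induct)
    case id
    then show ?case
      unfolding inv_id young_yamanouchi_id[OF D id(1,2)] young_yamanouchi_id[OF D id(2,1)] by auto
  next
    case (step k \<sigma>)
    let ?s = "transpose k (k + 1)"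
    note s = Sym_transpose[OF step(1)]
    have "inv (?s \<circ> \<sigma>) = inv \<sigma> \<circ> ?s"
      using step(2) s unfolding Sym_def
      by (simp add: o_inv_distrib permutes_bij)
    then have "D (inv (?s \<circ> \<sigma>)) T S = (\<Sum>U\<in>SYT L. D (inv \<sigma>) T U * D ?s U S)"
      using young_yamanouchi_comp[OF D step(5,4) inv_Sym[OF step(2)] s] by simp
    also have "\<dots> = (\<Sum>U\<in>SYT L. D ?s S U * D \<sigma> U T)"
      using step(3)[OF _ step(5)] young_yamanouchi_symmetric[OF L D step(4) _ step(1)]
      by (intro sum.cong) simp_all
    also have "\<dots> = D (?s \<circ> \<sigma>) S T"
      using young_yamanouchi_comp[OF D step(4,5) s step(2)] by simp
    finally show ?case by (rule sym)
  qed
  have "(\<Sum>T\<in>SYT L. D \<sigma> S T * D \<sigma> S T) = (\<Sum>T\<in>SYT L. D \<sigma> S T * D (inv \<sigma>) T S)"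
    using transposed[OF S] by simp
  also have "\<dots> = D (\<sigma> \<circ> inv \<sigma>) S S"
    using young_yamanouchi_comp[OF D S S \<sigma> inv_Sym[OF \<sigma>]] by simp
  also have "\<sigma> \<circ> inv \<sigma> = id"
    using \<sigma> unfolding Sym_def by (simp add: permutes_inv_o)
  finally show ?thesis
    unfolding young_yamanouchi_id[OF D S S] by simp
qed

section \<open>The conjugate representation as a sign twist, and the constant\<close>

lemma inj_conj_tableau: "inj_on conj_tableau A"
  by (metis inj_onI conj_tableau_conj_tableau)

lemma SYT_conj_diagram: "SYT (conj_diagram L) = conj_tableau ` SYT L"
  using conj_tableau_in_SYT conj_tableau_in_SYT[of _ "conj_diagram L"]
    conj_tableau_conj_tableau by (metis (no_types, lifting) conj_diagram_conj_diagram image_eqI image_subsetI subsetI subset_antisym)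

text \<open>The representation of the conjugate shape is the sign twist of \<open>D\<close>, once
  basis vectors are rescaled by tableau signs. In a product the signs of the intermediate tableau
  cancel.\<close>

lemma young_yamanouchi_conj_perm:
  assumes L: "L \<in> diagrams n" and D: "young_yamanouchi n L D"
    and E: "young_yamanouchi n (conj_diagram L) E" and T0: "T0 \<in> SYT L"
    and \<sigma>: "\<sigma> \<in> Sym n" and S: "S \<in> SYT L" and T: "T \<in> SYT L"
  shows "E \<sigma> (conj_tableau S) (conj_tableau T) =
    of_int (sign \<sigma> * (tableau_sign n T0 S * tableau_sign n T0 T)) * D \<sigma> S T"
  using \<sigma> S T
proof (induction arbitrary: S T rule: Sym_adjacent_induct)
  case id
  have "conj_tableau S = conj_tableau T \<longleftrightarrow> S = T"
    using conj_tableau_conj_tableau by metis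
  moreover have "of_int (tableau_sign n T0 T) * of_int (tableau_sign n T0 T) = (1 :: complex)"
    using tableau_sign_square[OF L T0 id(2)] by (metis of_int_1 of_int_mult)
  ultimately show ?case
    unfolding young_yamanouchi_id[OF D id]
      young_yamanouchi_id[OF E conj_tableau_in_SYT[OF id(1)] conj_tableau_in_SYT[OF id(2)]]
    by simp
next
  case (step k \<sigma>)
  let ?s = "transpose k (k + 1)" and ?g = "tableau_sign n T0"
  note s = Sym_transpose[OF step(1)]
  have "E (?s \<circ> \<sigma>) (conj_tableau S) (conj_tableau T) =
      (\<Sum>U\<in>SYT L. E ?s (conj_tableau S) (conj_tableau U) * E \<sigma> (conj_tableau U) (conj_tableau T))"
    unfolding young_yamanouchi_comp[OF E conj_tableau_in_SYT[OF step(4)] conj_tableau_in_SYT[OF step(5)] s step(2)]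
    unfolding SYT_conj_diagram sum.reindex[OF inj_conj_tableau] by simp
  also have "\<dots> = (\<Sum>U\<in>SYT L. - of_int (sign \<sigma> * (?g S * ?g T)) * (D ?s S U * D \<sigma> U T))"
  proof (rule sum.cong)
    fix U assume U: "U \<in> SYT L"
    have "E ?s (conj_tableau S) (conj_tableau U) * E \<sigma> (conj_tableau U) (conj_tableau T) =
        - of_int (sign \<sigma> * (?g S * ?g T) * (?g U * ?g U)) * (D ?s S U * D \<sigma> U T)"
      unfolding step(3)[OF U step(5)] young_yamanouchi_conj[OF L D E T0 step(4) U step(1)]
      by simp
    then show "E ?s (conj_tableau S) (conj_tableau U) * E \<sigma> (conj_tableau U) (conj_tableau T) =
        - of_int (sign \<sigma> * (?g S * ?g T)) * (D ?s S U * D \<sigma> U T)"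
      unfolding tableau_sign_square[OF L T0 U] by simp
  qed simp
  also have "\<dots> = - of_int (sign \<sigma> * (?g S * ?g T)) * D (?s \<circ> \<sigma>) S T"
    unfolding young_yamanouchi_comp[OF D step(4,5) s step(2)] by (simp only: sum_distrib_left)
  finally show ?case
    unfolding sign_transpose_comp(1)[OF step(1,2)] by (simp only: of_int_minus mult_minus_left)
qed

lemma sign_block_eq:
  assumes L: "L \<in> diagrams n" and M: "M \<in> diagrams n"
    and D: "young_yamanouchi n L D" and E: "young_yamanouchi n M E" and T0: "T0 \<in> SYT L"
    and S: "S \<in> SYT L" and R: "R \<in> SYT M" and S': "S' \<in> SYT L" and R': "R' \<in> SYT M"
  shows "sign_block n D E S R S' R' =
    (if M = conj_diagram L \<and> R = conj_tableau S \<and> R' = conj_tableau S'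
     then of_int (tableau_sign n T0 S * tableau_sign n T0 S') / of_nat (card (SYT L)) else 0)"
proof (cases "M = conj_diagram L")
  case False
  then show ?thesis
    using alternating_form[OF L M D E sign_block_alternating_left[OF D E S' R'] T0 S R] by simp
next
  case True
  let ?g = "tableau_sign n T0"
  \<comment> \<open>The block alternates in both index pairs, so \<open>alternating_form\<close>,
    applied to each, leaves this one unknown number.\<close>
  let ?c = "sign_block n D E T0 (conj_tableau T0) T0 (conj_tableau T0)"
  have cT0: "conj_tableau T0 \<in> SYT M"
    using conj_tableau_in_SYT[OF T0] True by simp
  have E': "young_yamanouchi n (conj_diagram L) E" using E True by simp
  have fst_arg: "sign_block n D E T0 (conj_tableau T0) A B =
      (if B = conj_tableau A then of_int (?g A) * ?c else 0)" if "A \<in> SYT L" "B \<in> SYT M" for A B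
    using alternating_form[OF L M D E sign_block_alternating_right[OF L M D E T0 cT0] T0 that] True
    by simp
  \<comment> \<open>Each copy of \<open>?c\<close> is rewritten as the mean over \<sigma> of the
    squared entry at \<open>(T0, T)\<close>; summing over \<open>T\<close> first gives the mean of
    squared row lengths, which is 1.\<close>
  have "of_nat (card (SYT L)) * ?c = (\<Sum>T\<in>SYT L. ?c)"
    by simp
  also have "\<dots> = (\<Sum>T\<in>SYT L. 1 / fact n * (\<Sum>\<sigma>\<in>Sym n. D \<sigma> T0 T * D \<sigma> T0 T))"
  proof (rule sum.cong)
    fix T assume T: "T \<in> SYT L"
    have g2: "of_int (?g T) * (of_int (?g T) * z) = z" for z :: complex
      using tableau_sign_square[OF L T0 T] by (metis mult.assoc mult_1 of_int_1 of_int_mult)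
    have s2: "of_int (sign \<sigma>) * (of_int (sign \<sigma>) * z) = z" for z :: complex and \<sigma> :: "nat \<Rightarrow> nat"
      by (metis mult.assoc mult_1 of_int_1 of_int_mult sign_idempotent)
    have cT: "conj_tableau T \<in> SYT M"
      using conj_tableau_in_SYT[OF T] True by simp
    have "?c = of_int (?g T) * sign_block n D E T0 (conj_tableau T0) T (conj_tableau T)"
      unfolding fst_arg[OF T cT] by (simp add: g2)
    also have "\<dots> = 1 / fact n * (\<Sum>\<sigma>\<in>Sym n. of_int (?g T) * (of_int (?g T) *
        (of_int (sign \<sigma>) * (of_int (sign \<sigma>) * (D \<sigma> T0 T * D \<sigma> T0 T)))))"
      using young_yamanouchi_conj_perm[OF L D E' T0 _ T0 T] tableau_sign_self[OF L T0]
      unfolding sign_block_def by (simp add: sum_distrib_left mult_ac)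
    finally show "?c = 1 / fact n * (\<Sum>\<sigma>\<in>Sym n. D \<sigma> T0 T * D \<sigma> T0 T)"
      unfolding g2 s2 .
  qed simp
  also have "\<dots> = 1 / fact n * (\<Sum>\<sigma>\<in>Sym n. \<Sum>T\<in>SYT L. D \<sigma> T0 T * D \<sigma> T0 T)"
    by (subst sum.swap) (simp only: sum_distrib_left)
  also have "\<dots> = 1 / fact n * of_nat (card (Sym n))"
    using young_yamanouchi_orthogonal[OF L D _ T0] by simp
  also have "card (Sym n) = fact n"
    unfolding Sym_def by (rule card_permutations) auto
  finally have "of_nat (card (SYT L)) * ?c = 1"
    by simp
  then have c: "?c = 1 / of_nat (card (SYT L))"
    by (metis nonzero_mult_div_cancel_left mult_zero_left zero_neq_one)
  have cS: "conj_tableau S \<in> SYT M" using conj_tableau_in_SYT[OF S] True by simp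
  show ?thesis
    using alternating_form[OF L M D E sign_block_alternating_left[OF D E S' R'] T0 S R]
    unfolding fst_arg[OF S' R'] c by (simp add: True)
qed

section \<open>From block entries to the operator on the tensor power\<close>

lemma psi_entry:
  assumes L: "L \<in> diagrams n" and S: "S \<in> SYT L"
  shows "psi n T0 L (S, R) = (if R = conj_tableau S
    then of_int (tableau_sign n T0 S) / complex_of_real (sqrt (real (card (SYT L)))) else 0)"
proof -
  have "(\<Sum>T\<in>SYT L. of_int (tableau_sign n T0 T) * (ket T S * ket (conj_tableau T) R)) =
    (\<Sum>T\<in>SYT L. if S = T then of_int (tableau_sign n T0 S) * ket (conj_tableau S) R else 0 :: complex)"
    by (intro sum.cong) (auto simp: ket_def)
  then show ?thesis
    using finite_SYT[OF L] S by (simp add: psi_def ket_def)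
qed

text \<open>The two factors \<open>1 / sqrt (card (SYT L))\<close> of the vector and its conjugate
  combine to the constant of the block.\<close>

lemma sign_block_eq_ketbra_psi:
  assumes L: "L \<in> diagrams n" and M: "M \<in> diagrams n"
    and D: "young_yamanouchi n L D" and E: "young_yamanouchi n M E" and T0: "T0 \<in> SYT L"
    and S: "S \<in> SYT L" and R: "R \<in> SYT M" and S': "S' \<in> SYT L" and R': "R' \<in> SYT M"
  shows "sign_block n D E S R S' R' =
    (if M = conj_diagram L then ketbra (psi n T0 L) (S, R) (S', R') else 0)"
proof -
  have "complex_of_real (sqrt (real m)) * complex_of_real (sqrt (real m)) = of_nat m" for m
    by (simp flip: of_real_mult)
  then show ?thesis
    unfolding sign_block_eq[OF assms] ketbra_def psi_entry[OF L S] psi_entry[OF L S']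
    by simp
qed

text \<open>The two unitaries bring all permutation operators to block form at once; the signed
  average can then be taken entrywise, one pair of blocks at a time.\<close>

theorem mainTheorem6:
  fixes d n :: nat
    and D :: "diagram \<Rightarrow> (nat \<Rightarrow> nat) \<Rightarrow> (tableau, tableau) cmat"
    and mA mB :: "diagram \<Rightarrow> nat"
    and \<Phi>A \<Phi>B :: "(nat \<Rightarrow> nat, diagram \<times> nat \<times> tableau) cmat"
    and T0 :: "diagram \<Rightarrow> tableau"
  assumes "\<And>L. L \<in> diagrams n \<Longrightarrow> young_yamanouchi n L (D L)"
    and "schur_weyl d n D mA \<Phi>A"
    and "schur_weyl d n D mB \<Phi>B"
    and "\<And>L. L \<in> diagrams n \<Longrightarrow> T0 L \<in> SYT L"
  shows "mat_eq (tidx d n \<times> tidx d n) (tidx d n \<times> tidx d n)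
           (P_as n)
           (transport (sw_idx n mA \<times> sw_idx n mB) (\<Phi>A \<otimes>\<^sub>M \<Phi>B)
              (conj_pair_dsum (\<lambda>L. ketbra (psi n (T0 L) L))))"
  unfolding mat_eq_def
proof (intro ballI)
  fix x y assume "x \<in> tidx d n \<times> tidx d n" "y \<in> tidx d n \<times> tidx d n"
  then obtain x1 x2 y1 y2 where xy: "x = (x1, x2)" "y = (y1, y2)"
    and mem: "x1 \<in> tidx d n" "x2 \<in> tidx d n" "y1 \<in> tidx d n" "y2 \<in> tidx d n"
    by auto
  let ?A = "sw_idx n mA" and ?B = "sw_idx n mB"
  let ?F = "\<lambda>\<sigma>. dsum (\<lambda>L. one_mat \<otimes>\<^sub>M D L \<sigma>) :: (diagram \<times> nat \<times> tableau, diagram \<times> nat \<times> tableau) cmat"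
  let ?W = "conj_pair_dsum (\<lambda>L. ketbra (psi n (T0 L) L))"
  have transport_entry: "transport K \<Phi> G a b = (\<Sum>q\<in>K. \<Sum>p\<in>K. \<Phi> a p * G p q * cnj (\<Phi> b q))"
    for K and \<Phi> :: "('i, 'k) cmat" and G a b
    by (simp add: transport_def mat_prod_def adj_def sum_distrib_right)
  \<comment> \<open>With equal block labels and equal unitary indices this is an entry of
    \<open>sign_block\<close>; otherwise both sides vanish.\<close>
  have block: "1 / fact n * (\<Sum>\<sigma>\<in>Sym n. of_int (sign \<sigma>) * (?F \<sigma> p q * ?F \<sigma> p' q')) = ?W (p, p') (q, q')"
    if "p \<in> ?A" "q \<in> ?A" "p' \<in> ?B" "q' \<in> ?B" for p q p' q'
  proof -
    obtain L u S L1 u1 S1 M w R M1 w1 R1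
      where eqs: "p = (L, u, S)" "q = (L1, u1, S1)" "p' = (M, w, R)" "q' = (M1, w1, R1)"
      by (metis surj_pair)
    have m: "L \<in> diagrams n" "M \<in> diagrams n" "S \<in> SYT L" "R \<in> SYT M" "S1 \<in> SYT L1" "R1 \<in> SYT M1"
      using that unfolding eqs sw_idx_def by auto
    show ?thesis
    proof (cases "L = L1 \<and> M = M1 \<and> u = u1 \<and> w = w1")
      case True
      then have "1 / fact n * (\<Sum>\<sigma>\<in>Sym n. of_int (sign \<sigma>) * (?F \<sigma> p q * ?F \<sigma> p' q')) =
          sign_block n (D L) (D M) S R S1 R1"
        unfolding eqs sign_block_def by (simp add: dsum_def tensor_def one_mat_def)
      also have "\<dots> = (if M = conj_diagram L then ketbra (psi n (T0 L) L) (S, R) (S1, R1) else 0)"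
        using m True assms(1,4) by (intro sign_block_eq_ketbra_psi) auto
      also have "\<dots> = ?W (p, p') (q, q')"
        using True unfolding eqs
        by (simp add: conj_pair_dsum_def reorder_def dsum_def tensor_def one_mat_def)
      finally show ?thesis .
    next
      case False
      then have "?F \<sigma> p q * ?F \<sigma> p' q' = 0" for \<sigma>
        unfolding eqs by (auto simp: dsum_def tensor_def one_mat_def)
      moreover have "?W (p, p') (q, q') = 0"
        using False unfolding eqs
        by (auto simp: conj_pair_dsum_def reorder_def dsum_def tensor_def one_mat_def)
      ultimately show ?thesis by (simp only: mult_zero_right sum.neutral_const)
    qed
  qed
  have perm_A: "perm_op \<sigma> x1 y1 = (\<Sum>q\<in>?A. \<Sum>p\<in>?A. \<Phi>A x1 p * ?F \<sigma> p q * cnj (\<Phi>A y1 q))"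
    if "\<sigma> \<in> Sym n" for \<sigma>
    using assms(2) that mem unfolding schur_weyl_def mat_eq_def transport_entry by blast
  have perm_B: "perm_op \<sigma> x2 y2 = (\<Sum>q\<in>?B. \<Sum>p\<in>?B. \<Phi>B x2 p * ?F \<sigma> p q * cnj (\<Phi>B y2 q))"
    if "\<sigma> \<in> Sym n" for \<sigma>
    using assms(3) that mem unfolding schur_weyl_def mat_eq_def transport_entry by blast
  let ?t = "\<lambda>p p' q q'. \<Phi>A x1 p * \<Phi>B x2 p' * (cnj (\<Phi>A y1 q) * cnj (\<Phi>B y2 q'))"
  have pairs: "(\<Sum>q\<in>?A. \<Sum>p\<in>?A. f q p) * (\<Sum>q'\<in>?B. \<Sum>p'\<in>?B. g q' p') =
      (\<Sum>(q, q')\<in>?A \<times> ?B. \<Sum>(p, p')\<in>?A \<times> ?B. f q p * g q' p')" for f g :: "_ \<Rightarrow> _ \<Rightarrow> complex"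
    by (simp add: sum_product flip: sum.cartesian_product)
  have "P_as n x y = 1 / fact n * (\<Sum>\<sigma>\<in>Sym n. of_int (sign \<sigma>) *
      (\<Sum>(q, q')\<in>?A \<times> ?B. \<Sum>(p, p')\<in>?A \<times> ?B. ?t p p' q q' * (?F \<sigma> p q * ?F \<sigma> p' q')))"
    using perm_A perm_B unfolding P_as_def xy tensor_def fst_conv snd_conv
    by (simp add: pairs mult_ac)
  also have "\<dots> = (\<Sum>\<sigma>\<in>Sym n. \<Sum>Q\<in>?A \<times> ?B. \<Sum>P\<in>?A \<times> ?B. ?t (fst P) (snd P) (fst Q) (snd Q) *
      (1 / fact n * (of_int (sign \<sigma>) * (?F \<sigma> (fst P) (fst Q) * ?F \<sigma> (snd P) (snd Q)))))"
    by (simp add: sum_distrib_left case_prod_unfold mult_ac)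
  \<comment> \<open>The coefficients \<open>?t\<close> of the change of basis do not depend on
    \<sigma>, so the average moves inside, where \<open>block\<close> evaluates it.\<close>
  also have "\<dots> = (\<Sum>Q\<in>?A \<times> ?B. \<Sum>P\<in>?A \<times> ?B. \<Sum>\<sigma>\<in>Sym n. ?t (fst P) (snd P) (fst Q) (snd Q) *
      (1 / fact n * (of_int (sign \<sigma>) * (?F \<sigma> (fst P) (fst Q) * ?F \<sigma> (snd P) (snd Q)))))"
    by (subst sum.swap) (intro sum.cong refl sum.swap)
  also have "\<dots> = (\<Sum>Q\<in>?A \<times> ?B. \<Sum>P\<in>?A \<times> ?B. ?t (fst P) (snd P) (fst Q) (snd Q) * ?W P Q)"
  proof (intro sum.cong refl)
    fix P Q assume "Q \<in> ?A \<times> ?B" "P \<in> ?A \<times> ?B"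
    then have "1 / fact n * (\<Sum>\<sigma>\<in>Sym n. of_int (sign \<sigma>) *
        (?F \<sigma> (fst P) (fst Q) * ?F \<sigma> (snd P) (snd Q))) = ?W P Q"
      using block[of "fst P" "fst Q" "snd P" "snd Q"] by auto
    then show "(\<Sum>\<sigma>\<in>Sym n. ?t (fst P) (snd P) (fst Q) (snd Q) *
      (1 / fact n * (of_int (sign \<sigma>) * (?F \<sigma> (fst P) (fst Q) * ?F \<sigma> (snd P) (snd Q))))) =
      ?t (fst P) (snd P) (fst Q) (snd Q) * ?W P Q"
      by (simp only: flip: sum_distrib_left)
  qed
  also have "\<dots> = transport (?A \<times> ?B) (\<Phi>A \<otimes>\<^sub>M \<Phi>B) ?W x y"
    unfolding transport_entry xy by (simp add: tensor_def mult_ac)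
  finally show "P_as n x y = transport (?A \<times> ?B) (\<Phi>A \<otimes>\<^sub>M \<Phi>B) ?W x y" .
qed

end
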